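(* There exists an exhaustive vector-valued measure that does not have a control measure. That is, there exist a topological vector space $X$ with a metrizable topology defined by a translation invariant distance $d$, a Boolean algebra $\mathcal{B}$ of subsets of a set $T$, and an exhaustive $X$-valued vector measure $\theta:\mathcal{B}\to X$ such that $\theta$ has no control measure.
   Context: Let $X$ be a (real) topological vector space with a metrizable topology, $d$ a translation invariant distance defining this topology, and $\mathcal{B}$ a Boolean algebra of subsets of a set $T$. An ($X$-valued) vector measure is a map $\theta:\mathcal{B}\to X$ such that $\theta(A\cup B)=\theta(A)+\theta(B)$ whenever $A\cap B=\varnothing$. It is exhaustive if $\lim_{n\to\infty}\theta(E_n)=0$ for each sequence $(E_n)$ of pairwise disjoint elements of $\mathcal{B}$. A positive measure $\mu$ on $\mathcal{B}$ (that is, a map $\mu:\mathcal{B}\to[0,\infty)$ with $\mu(\varnothing)=0$ and $\mu(A\cup B)=\mu(A)+\mu(B)$ whenever $A\cap B=\varnothing$) is called a control measure for $\theta$ if for every $\varepsilon>0$ there is $\alpha>0$ such that, for all $A\in\mathcal{B}$, $\mu(A)\le\alpha$ implies $d(0,\theta(A))\le\varepsilon$. *)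

theory Defs
  imports "HOL-Algebra.Algebraic_Closure_Type" "HOL-Analysis.Analysis"
begin

text \<open>
  The spaces are carrier-based, so that one can quantify existentially over them: a real vector
  space is an HOL-Algebra module over \<^term>\<open>ring_of_type_algebra :: real ring\<close>, the field of real
  numbers. The fields \<^const>\<open>monoid.mult\<close> and \<^const>\<open>one\<close> that a module record inherits from
  \<open>'x ring\<close> are not constrained by the module axioms and play no role.
\<close>

locale topological_vector_space =
  Module.module "ring_of_type_algebra :: real ring" V
  for V :: "(real, 'x) module" (structure) +
  fixes \<tau> :: "'x topology"
  assumes topspace_carrier: "topspace \<tau> = carrier V"
    and continuous_add: "continuous_map (prod_topology \<tau> \<tau>) \<tau> (\<lambda>(x, y). x \<oplus> y)"
    and continuous_smult: "continuous_map (prod_topology euclideanreal \<tau>) \<tau> (\<lambda>(a, x). a \<odot> x)"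

locale invariantly_metrized_tvs =
  topological_vector_space V \<tau> + metric: Metric_space "carrier V" d
  for V :: "(real, 'x) module" (structure) and \<tau> :: "'x topology" and d :: "'x \<Rightarrow> 'x \<Rightarrow> real" +
  assumes metric_topology: "metric.mtopology = \<tau>"
    and translation_invariant:
      "\<lbrakk>x \<in> carrier V; y \<in> carrier V; z \<in> carrier V\<rbrakk> \<Longrightarrow> d (x \<oplus> z) (y \<oplus> z) = d x y"

definition vector_measure ::
    "'t set set \<Rightarrow> (real, 'x) module \<Rightarrow> ('t set \<Rightarrow> 'x) \<Rightarrow> bool" where
  "vector_measure \<B> V \<theta> \<longleftrightarrow>
     \<theta> \<in> \<B> \<rightarrow> carrier V \<and>
     (\<forall>A\<in>\<B>. \<forall>B\<in>\<B>. A \<inter> B = {} \<longrightarrow> \<theta> (A \<union> B) = \<theta> A \<oplus>\<^bsub>V\<^esub> \<theta> B)"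

definition exhaustive ::
    "'t set set \<Rightarrow> (real, 'x) module \<Rightarrow> 'x topology \<Rightarrow> ('t set \<Rightarrow> 'x) \<Rightarrow> bool" where
  "exhaustive \<B> V \<tau> \<theta> \<longleftrightarrow>
     (\<forall>E :: nat \<Rightarrow> 't set. range E \<subseteq> \<B> \<and> disjoint_family E \<longrightarrow>
        limitin \<tau> (\<lambda>n. \<theta> (E n)) \<zero>\<^bsub>V\<^esub> sequentially)"

text \<open>Finitely additive; \<^const>\<open>measure\<close> of HOL-Analysis would be countably additive.\<close>

definition positive_measure :: "'t set set \<Rightarrow> ('t set \<Rightarrow> real) \<Rightarrow> bool" where
  "positive_measure \<B> \<mu> \<longleftrightarrow> (\<forall>A\<in>\<B>. 0 \<le> \<mu> A) \<and> \<mu> {} = 0 \<and> Measure_Space.additive \<B> \<mu>"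

definition control_measure ::
    "'t set set \<Rightarrow> (real, 'x) module \<Rightarrow> ('x \<Rightarrow> 'x \<Rightarrow> real) \<Rightarrow> ('t set \<Rightarrow> 'x) \<Rightarrow>
     ('t set \<Rightarrow> real) \<Rightarrow> bool" where
  "control_measure \<B> V d \<theta> \<mu> \<longleftrightarrow>
     positive_measure \<B> \<mu> \<and>
     (\<forall>\<epsilon>>0. \<exists>\<alpha>>0. \<forall>A\<in>\<B>. \<mu> A \<le> \<alpha> \<longrightarrow> d \<zero>\<^bsub>V\<^esub> (\<theta> A) \<le> \<epsilon>)"

end

theory Submission
  imports Defs
begin

text \<open>
  The proof is a variant of Talagrand's construction of an exhaustive submeasure that no measure
  controls. A set \<open>E\<close> with a finite set \<open>I\<close> of cuts is admitted at level \<open>k\<close> if for all cuts \<open>m < n\<close>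
  every cylinder of length \<open>m\<close> contains a set that depends on the first \<open>n\<close> coordinates only, avoids
  \<open>E\<close>, and is large for the submeasure generated by the levels above \<open>k\<close>. Its weight is \<open>2^-k\<close> if \<open>I\<close>
  is as large as permitted, and a very small power of \<open>1 / card I\<close> governs the growth of the weight
  for smaller \<open>I\<close>. The levels are first cut off at \<open>p\<close>; then \<open>p\<close> tends to infinity along an ultrafilter.

  Main estimate: families of total weight less than 8 do not cover the space. The sets of level \<open>k\<close>
  in such a family are few and have many cuts, so they can be avoided in disjoint windows of
  coordinates that are nearly free of sets of higher level. The latter are distributed over the
  remaining windows, which hardly increases their weights, and avoided by induction.

  For a disjoint sequence of clopen sets, all late terms are thin up to sets of small weight, so
  adding cuts one at a time makes their weights tend to \<open>2^-k\<close>, for every \<open>k\<close>. On the other hand sets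
  \<open>{z. \<forall>i\<in>I. z i \<noteq> t i}\<close> are thin and hence light, while for a given measure their complements can be
  made arbitrarily small; so no measure controls the submeasure. The vector measure sends a clopen
  set to its indicator, in the functions of finitely many coordinates with the metric of
  convergence in submeasure.
\<close>

section \<open>Clopen sets\<close>

text \<open>
  Coordinate \<open>i\<close> of a point is read modulo \<open>i + 1\<close>. This replaces the compact product of the
  finite sets \<open>{0..i}\<close> by the whole type, with the same algebra of clopen sets.
\<close>

definition agree :: "nat \<Rightarrow> (nat \<Rightarrow> nat) \<Rightarrow> (nat \<Rightarrow> nat) \<Rightarrow> bool" where
  "agree n z z' \<longleftrightarrow> (\<forall>i<n. z i mod Suc i = z' i mod Suc i)"

definition depends :: "nat \<Rightarrow> (nat \<Rightarrow> nat) set \<Rightarrow> bool" where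
  "depends n Y \<longleftrightarrow> (\<forall>z z'. agree n z z' \<longrightarrow> z \<in> Y \<longrightarrow> z' \<in> Y)"

text \<open>
  With \<open>A\<close> the cylinder of the first \<open>m\<close> coordinates of \<open>a\<close>, \<open>graft m a\<close> is Talagrand's map
  $\pi_A$ from the whole space to \<open>A\<close>.
\<close>

definition graft :: "nat \<Rightarrow> (nat \<Rightarrow> nat) \<Rightarrow> (nat \<Rightarrow> nat) \<Rightarrow> nat \<Rightarrow> nat" where
  "graft m a z = (\<lambda>i. if i < m then a i else z i)"

definition cyl_hull :: "nat \<Rightarrow> (nat \<Rightarrow> nat) set \<Rightarrow> (nat \<Rightarrow> nat) set" where
  "cyl_hull n Y = {z. \<exists>e\<in>Y. agree n z e}"

text \<open>Independence of the first \<open>m\<close> coordinates. One implication suffices,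
  because grafting the original coordinates back returns the point
  (\<open>tail_set_iff\<close>).\<close>

definition tail_set :: "nat \<Rightarrow> (nat \<Rightarrow> nat) set \<Rightarrow> bool" where
  "tail_set m Y \<longleftrightarrow> (\<forall>a z. z \<in> Y \<longrightarrow> graft m a z \<in> Y)"

lemma agree_refl [simp]: "agree n z z"
  by (simp add: agree_def)

lemma agree_sym: "agree n z z' \<Longrightarrow> agree n z' z"
  by (simp add: agree_def)

lemma agree_trans: "agree n x y \<Longrightarrow> agree n y z \<Longrightarrow> agree n x z"
  by (simp add: agree_def)

lemma agree_mono: "agree n x y \<Longrightarrow> m \<le> n \<Longrightarrow> agree m x y"
  by (simp add: agree_def)

lemma depD: "depends n Y \<Longrightarrow> agree n z z' \<Longrightarrow> z \<in> Y \<Longrightarrow> z' \<in> Y"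
  by (auto simp: depends_def)

lemma depends_iff: "depends n Y \<Longrightarrow> agree n z z' \<Longrightarrow> z \<in> Y \<longleftrightarrow> z' \<in> Y"
  by (meson depD agree_sym)

lemma depends_mono: "depends m Y \<Longrightarrow> m \<le> n \<Longrightarrow> depends n Y"
  using agree_mono by (force simp: depends_def)

lemma depends_empty [simp]: "depends n {}" and depends_UNIV [simp]: "depends n UNIV"
  by (auto simp: depends_def)

lemma depends_Compl: "depends n Y \<Longrightarrow> depends n (- Y)"
  unfolding depends_def using agree_sym by blast

lemma depends_Un: "depends n Y \<Longrightarrow> depends n Z \<Longrightarrow> depends n (Y \<union> Z)"
  by (auto simp: depends_def)

lemma depends_UN: "(\<And>i. i \<in> S \<Longrightarrow> depends n (Y i)) \<Longrightarrow> depends n (\<Union>i\<in>S. Y i)"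
  by (fastforce simp: depends_def)

lemma depends_INT: "(\<And>i. i \<in> S \<Longrightarrow> depends n (Y i)) \<Longrightarrow> depends n (\<Inter>i\<in>S. Y i)"
  by (fastforce simp: depends_def)

lemma depends_cyl_hull: "depends n (cyl_hull n Y)"
  by (auto simp: depends_def cyl_hull_def intro: agree_trans agree_sym)

lemma graft_graft [simp]: "graft m a (graft m b z) = graft m a z"
  by (auto simp: graft_def)

lemma graft_self [simp]: "graft m z z = z"
  by (auto simp: graft_def)

lemma graft_0 [simp]: "graft 0 a z = z"
  by (auto simp: graft_def)

lemma graft_graft_le: "m \<le> n \<Longrightarrow> graft m a (graft n b z) = graft n (graft m a b) z"
  by (auto simp: graft_def)

lemma agree_graft [simp]: "agree m (graft m a z) a" "agree m a (graft m a z)"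
  by (auto simp: graft_def agree_def)

lemma agree_graft_cong: "agree n z z' \<Longrightarrow> agree n (graft m a z) (graft m a z')"
  by (auto simp: graft_def agree_def)

lemma agree_graft_same: "agree m a z \<Longrightarrow> agree n (graft m a z) z"
  by (auto simp: graft_def agree_def)

lemma tail_set_iff: "tail_set m Y \<Longrightarrow> graft m a z \<in> Y \<longleftrightarrow> z \<in> Y"
  unfolding tail_set_def by (metis graft_graft graft_self)

lemma tail_set_vimage [simp]: "tail_set m {z. graft m a z \<in> Y}"
  by (auto simp: tail_set_def)

lemma tail_set_Compl: "tail_set m Y \<Longrightarrow> tail_set m (- Y)"
  by (simp add: tail_set_def tail_set_iff)

lemma tail_set_UN: "(\<And>i. i \<in> S \<Longrightarrow> tail_set m (Y i)) \<Longrightarrow> tail_set m (\<Union>i\<in>S. Y i)"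
  by (fastforce simp: tail_set_def)

lemma tail_set_cyl_hull: "tail_set m Y \<Longrightarrow> tail_set m (cyl_hull n Y)"
  unfolding tail_set_def cyl_hull_def using agree_graft_cong by blast

lemma depends_vimage: "depends n Y \<Longrightarrow> depends n {z. graft m a z \<in> Y}"
  by (auto simp: depends_def intro: agree_graft_cong)

text \<open>A canonical point of each cylinder of length \<open>n\<close>. Only finitely many occur,
  so choices made cylinder by cylinder are finite in number, and so are the sets of a given
  depth.\<close>

definition rep :: "nat \<Rightarrow> (nat \<Rightarrow> nat) \<Rightarrow> nat \<Rightarrow> nat" where
  "rep n z = (\<lambda>i. if i < n then z i mod Suc i else 0)"

lemma agree_rep [simp]: "agree n (rep n z) z" "agree n z (rep n z)"
  by (auto simp: rep_def agree_def)

lemma agree_iff_rep: "agree n z z' \<longleftrightarrow> rep n z = rep n z'"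
  by (auto simp: rep_def agree_def fun_eq_iff)

lemma finite_range_rep: "finite (range (rep n))"
proof -
  have "range (rep n) \<subseteq> {f. \<forall>i. (i \<in> {..<n} \<longrightarrow> f i \<in> {..n}) \<and> (i \<notin> {..<n} \<longrightarrow> f i = 0)}"
    by (force simp: rep_def intro: order_trans[OF mod_Suc_le_divisor])
  moreover have "finite \<dots>"
    by (rule finite_set_of_finite_funs) auto
  ultimately show ?thesis by (rule finite_subset)
qed

lemma finite_depends: "finite {Y. depends n Y}"
proof -
  have "Y = {z. rep n z \<in> rep n ` Y}" if "depends n Y" for Y
    unfolding image_iff agree_iff_rep[symmetric] using that by (blast intro: agree_refl depD agree_sym)
  then have "{Y. depends n Y} \<subseteq> (\<lambda>Z. {z. rep n z \<in> Z}) ` Pow (range (rep n))"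
    by blast
  then show ?thesis
    by (rule finite_subset) (simp add: finite_range_rep)
qed

section \<open>Weights\<close>

text \<open>Bounds the number of cuts that \<open>greedy\<close> consumes in
  \<open>big_UNIV\<close>: a family of weight below 16 has fewer than \<open>2 ^ (k + 4)\<close>
  members of level \<open>k\<close>, and each of them uses up at most \<open>t + 1\<close> cuts,
  with \<open>t = 32 * 2 ^ (k + 6)\<close>.\<close>

definition min_card :: "nat \<Rightarrow> nat" where
  "min_card k = 2 ^ (k + 4) * (32 * 2 ^ (k + 6) + 1)"

text \<open>For \<open>l > k\<close> this makes \<open>wexp l\<close> at least
  \<open>(k + 6) * 2 ^ (k + 2)\<close>, so that keeping one cut in \<open>2 ^ (k + 6)\<close>
  multiplies a weight of level \<open>l\<close> by at most
  \<open>2 powr (1 / 2 ^ (k + 2))\<close>.\<close>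

definition wexp :: "nat \<Rightarrow> nat" where
  "wexp k = (k + 5) * 2 ^ (k + 1)"

text \<open>The ratio to \<open>min_card k\<close> is such that \<open>min_card k\<close> cuts give
  weight exactly 16: its root of order \<open>wexp k\<close> is \<open>2 ^ (k + 4)\<close>.\<close>

definition max_card :: "nat \<Rightarrow> nat" where
  "max_card k = min_card k * 2 ^ ((k + 4) * wexp k)"

definition weight :: "nat \<Rightarrow> nat \<Rightarrow> real" where
  "weight k n = (1 / 2) ^ k * (max_card k / n) powr (1 / wexp k)"

text \<open>Starts at 8 and stays below 16. The increase by \<open>16 / 2 ^ (k + 2)\<close> from
  \<open>k\<close> to \<open>Suc k\<close> pays for the factor \<open>1 + 1 / 2 ^ (k + 2)\<close> by
  which weights grow in the induction step of \<open>big_UNIV\<close>.\<close>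

definition level_bound :: "nat \<Rightarrow> real" where
  "level_bound k = 16 - 8 / 2 ^ k"

lemma wexp_pos [simp]: "0 < wexp k"
  by (simp add: wexp_def)

lemma min_card_pos [simp]: "0 < min_card k"
  by (simp add: min_card_def)

lemma max_card_pos [simp]: "0 < max_card k"
  by (simp add: max_card_def)

lemma min_card_gt: "k + 3 < min_card k"
proof -
  have "k < 2 ^ k" by (rule less_exp)
  then have "k + 3 < 16 * 2 ^ k" by linarith
  then have "k + 3 < 2 ^ (k + 4)" by (simp add: power_add)
  also have "\<dots> \<le> min_card k" by (simp add: min_card_def)
  finally show ?thesis .
qed

lemma weight_max_card [simp]: "weight k (max_card k) = (1 / 2) ^ k"
  by (simp add: weight_def)

lemma weight_nonneg [simp]: "0 \<le> weight k n"
  by (simp add: weight_def)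

lemma weight_ge:
  assumes "0 < n" "n \<le> max_card k"
  shows "(1 / 2) ^ k \<le> weight k n"
proof -
  have "1 \<le> (max_card k / n) powr (1 / wexp k)"
    using assms by (intro ge_one_powr_ge_zero) auto
  then show ?thesis by (simp add: weight_def)
qed

lemma card_gt_min_card:
  assumes "0 < n" "weight k n < 16"
  shows "min_card k < n"
proof (rule ccontr)
  assume "\<not> min_card k < n"
  then have "real n \<le> min_card k" by simp
  then have "n * 2 ^ ((k + 4) * wexp k) \<le> real (max_card k)"
    by (simp add: max_card_def)
  then have "2 ^ ((k + 4) * wexp k) \<le> max_card k / n"
    using assms(1) by (simp add: field_simps)
  then have "(2 ^ ((k + 4) * wexp k)) powr (1 / wexp k) \<le> (max_card k / n) powr (1 / wexp k)"
    by (intro powr_mono2) auto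
  moreover have "((2::real) ^ ((k + 4) * wexp k)) powr (1 / wexp k) = 2 ^ (k + 4)"
    by (simp add: powr_realpow[symmetric] powr_powr del: power_add)
  ultimately have "(1 / 2) ^ k * 2 ^ (k + 4) \<le> weight k n"
    by (simp add: weight_def)
  then show False
    using assms(2) by (simp add: power_add power_one_over)
qed

lemma weight_shrink:
  assumes "0 < j" "0 < n" "n \<le> R * j"
  shows "weight l j \<le> real R powr (1 / wexp l) * weight l n"
proof -
  have "real n \<le> R * j"
    using assms(3) by (simp flip: of_nat_mult)
  then have "max_card l / j \<le> R * (max_card l / n)"
    using assms(1,2) by (simp add: field_simps)
  then have "(max_card l / j) powr (1 / wexp l) \<le> (R * (max_card l / n)) powr (1 / wexp l)"
    by (intro powr_mono2) auto
  also have "\<dots> = R powr (1 / wexp l) * (max_card l / n) powr (1 / wexp l)"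
    by (rule powr_mult)
  finally show ?thesis
    by (simp add: weight_def mult.left_commute)
qed

lemma weight_shrink_less:
  assumes "k < l" "0 < j" "0 < n" "n \<le> 2 ^ (k + 6) * j"
  shows "weight l j \<le> (1 + 1 / 2 ^ (k + 2)) * weight l n"
proof -
  define b :: nat where "b = 2 ^ (k + 2)"
  have b: "0 < b" by (simp add: b_def)
  have "(k + 6) * b \<le> wexp l"
    unfolding wexp_def b_def using assms(1) by (intro mult_le_mono power_increasing) auto
  then have "real ((k + 6) * b) \<le> wexp l" by (rule of_nat_mono)
  then have *: "real (k + 6) / wexp l \<le> 1 / b"
    using b by (simp add: field_simps)
  have "real (2 ^ (k + 6)) powr (1 / wexp l) = 2 powr (real (k + 6) / wexp l)"
    by (simp add: powr_realpow[symmetric] powr_powr del: power_add)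
  also have "\<dots> \<le> 2 powr (1 / b)"
    using * by (intro powr_mono) auto
  \<comment> \<open>Bernoulli's inequality gives \<open>2 \<le> (1 + 1 / b) ^ b\<close>.\<close>
  also have "\<dots> \<le> ((1 + 1 / b) ^ b) powr (1 / b)"
    using Bernoulli_inequality[OF order_trans[of _ 0 "1 / real b"], of b] b by (intro powr_mono2) auto
  also have "\<dots> = 1 + 1 / b"
    using b by (simp add: powr_realpow[symmetric] powr_powr add_pos_pos)
  finally have "real (2 ^ (k + 6)) powr (1 / wexp l) \<le> 1 + 1 / 2 ^ (k + 2)"
    by (simp add: b_def)
  then have "real (2 ^ (k + 6)) powr (1 / wexp l) * weight l n \<le> (1 + 1 / 2 ^ (k + 2)) * weight l n"
    by (intro mult_right_mono) auto
  with weight_shrink[OF assms(2-4), of l] show ?thesis by linarith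
qed

text \<open>A crude bound for all levels at once: the exponent \<open>1 / wexp l\<close> is at most
  1/2, so keeping a third of the cuts at most doubles the weight.\<close>

lemma weight_shrink3:
  assumes "0 < j" "0 < n" "n \<le> 3 * j"
  shows "weight l j \<le> 2 * weight l n"
proof -
  have "2 * 1 \<le> wexp l"
    unfolding wexp_def by (intro mult_le_mono) auto
  then have "real 2 \<le> real (wexp l)" by (intro of_nat_mono) simp
  then have *: "2 / real (wexp l) \<le> 1" by simp
  have "real 3 powr (1 / wexp l) \<le> 4 powr (1 / wexp l)"
    by (intro powr_mono2) auto
  also have "(4::real) = 2 powr 2" by simp
  also have "(2 powr 2) powr (1 / wexp l) = 2 powr (2 / wexp l)"
    by (simp only: powr_powr) simp
  also have "\<dots> \<le> 2 powr 1"
    using * by (intro powr_mono) auto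
  finally have "real 3 powr (1 / wexp l) * weight l n \<le> 2 * weight l n"
    by (intro mult_right_mono) auto
  with weight_shrink[OF assms, of l] show ?thesis by linarith
qed

lemma level_bound_bounds: "8 \<le> level_bound k" "level_bound k < 16"
  by (auto simp: level_bound_def divide_le_eq)

lemma level_bound_Suc: "(1 + 1 / 2 ^ (k + 2)) * level_bound k \<le> level_bound (Suc k)"
proof -
  have "level_bound k / 2 ^ (k + 2) \<le> 16 / 2 ^ (k + 2)"
    using level_bound_bounds(2)[of k] by (intro divide_right_mono) auto
  also have "\<dots> = level_bound (Suc k) - level_bound k"
    by (simp add: level_bound_def field_simps)
  finally show ?thesis by (simp add: algebra_simps)
qed

section \<open>The main estimate\<close>

type_synonym wset = "nat \<times> (nat \<Rightarrow> nat) set \<times> nat set"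

abbreviation level :: "wset \<Rightarrow> nat" where "level x \<equiv> fst x"
abbreviation region :: "wset \<Rightarrow> (nat \<Rightarrow> nat) set" where "region x \<equiv> fst (snd x)"
abbreviation cuts :: "wset \<Rightarrow> nat set" where "cuts x \<equiv> snd (snd x)"

definition wt :: "wset \<Rightarrow> real" where
  "wt x = weight (level x) (card (cuts x))"

text \<open>The submeasure generated by \<open>D\<close> is at least \<open>c\<close> on
  \<open>Y\<close>. A set without a finite cover counts as having infinite submeasure, which avoids
  an infimum over the empty set.\<close>

definition big :: "wset set \<Rightarrow> real \<Rightarrow> (nat \<Rightarrow> nat) set \<Rightarrow> bool" where
  "big D c Y \<longleftrightarrow> (\<forall>F. finite F \<longrightarrow> F \<subseteq> D \<longrightarrow> Y \<subseteq> (\<Union>x\<in>F. region x) \<longrightarrow> c \<le> sum wt F)"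

text \<open>
  Since \<open>C\<close> is pulled back along \<open>graft m a\<close>, it plays the role of $\pi_A^{-1}(C)$ in the paper.
\<close>

definition thin :: "wset set \<Rightarrow> nat \<Rightarrow> nat \<Rightarrow> (nat \<Rightarrow> nat) set \<Rightarrow> bool" where
  "thin D m n E \<longleftrightarrow> (\<forall>a. \<exists>C. depends n C \<and> (\<forall>z\<in>C. graft m a z \<notin> E) \<and> big D 1 C)"

definition adm :: "wset set \<Rightarrow> wset \<Rightarrow> bool" where
  "adm D x \<longleftrightarrow> finite (cuts x) \<and> cuts x \<noteq> {} \<and> card (cuts x) \<le> max_card (level x) \<and> depends (Max (cuts x)) (region x) \<and>
     (\<forall>m\<in>cuts x. \<forall>n\<in>cuts x. m < n \<longrightarrow> thin D m n (region x))"

text \<open>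
  Thinness at level \<open>k\<close> refers to the submeasure generated by the levels above \<open>k\<close>. Cutting off at
  level \<open>p\<close> makes this a recursion; \<open>stage p j\<close> holds the levels \<open>p - j, \<dots>, p - 1\<close>.
\<close>

primrec stage :: "nat \<Rightarrow> nat \<Rightarrow> wset set" where
  "stage p 0 = {}"
| "stage p (Suc j) = stage p j \<union> {x. level x = p - Suc j \<and> adm (stage p j) x}"

definition wclass :: "nat \<Rightarrow> nat \<Rightarrow> wset set" where
  "wclass p k = stage p (p - k)"

text \<open>
  The trace of a weighted set in the window \<open>{m..<n}\<close> of coordinates, seen from the cylinder of \<open>a\<close>.
  It belongs to the same class, at the price of a smaller index set and hence a larger weight.
\<close>

definition localize :: "nat \<Rightarrow> nat \<Rightarrow> (nat \<Rightarrow> nat) \<Rightarrow> wset \<Rightarrow> wset" where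
  "localize m n a x = (level x, cyl_hull (Max (cuts x \<inter> {m..<n})) {z. graft m a z \<in> region x}, cuts x \<inter> {m..<n})"

lemma wt_nonneg [simp]: "0 \<le> wt x"
  by (simp add: wt_def)

lemma bigD: "big D c Y \<Longrightarrow> finite F \<Longrightarrow> F \<subseteq> D \<Longrightarrow> Y \<subseteq> (\<Union>x\<in>F. region x) \<Longrightarrow> c \<le> sum wt F"
  by (simp add: big_def)

lemma wclass_ge: "p \<le> k \<Longrightarrow> wclass p k = {}"
  by (simp add: wclass_def)

lemma wclass_less: "k < p \<Longrightarrow> wclass p k = wclass p (Suc k) \<union> {x. level x = k \<and> adm (wclass p (Suc k)) x}"
proof -
  assume "k < p"
  then have "p - k = Suc (p - Suc k)" "p - Suc (p - Suc k) = k" by auto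
  then show ?thesis by (simp add: wclass_def)
qed

text \<open>The recursion in closed form: a member is tested only against the levels above its own,
  whatever \<open>k\<close> is. So raising \<open>k\<close> merely discards levels.\<close>

lemma wclass_iff: "x \<in> wclass p k \<longleftrightarrow> k \<le> level x \<and> level x < p \<and> adm (wclass p (Suc (level x))) x"
proof (induction "p - k" arbitrary: k)
  case 0
  then show ?case by (auto simp: wclass_ge)
next
  case (Suc j)
  then have "k < p" "x \<in> wclass p (Suc k) \<longleftrightarrow> Suc k \<le> level x \<and> level x < p \<and> adm (wclass p (Suc (level x))) x"
    by auto
  then have "x \<in> wclass p k \<longleftrightarrow> (Suc k \<le> level x \<and> level x < p \<and> adm (wclass p (Suc (level x))) x) \<or>
      (level x = k \<and> adm (wclass p (Suc (level x))) x)"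
    unfolding wclass_less[OF \<open>k < p\<close>] Un_iff by blast
  with \<open>k < p\<close> show ?case by (metis Suc_le_eq le_less)
qed

lemma wclass_mono: "k \<le> k' \<Longrightarrow> wclass p k' \<subseteq> wclass p k"
  by (auto simp: wclass_iff)

lemma adm_card: "adm D x \<Longrightarrow> 0 < card (cuts x)"
  by (simp add: adm_def card_gt_0_iff)

lemma wclass_card: "x \<in> wclass p k \<Longrightarrow> 0 < card (cuts x)"
  by (meson adm_card wclass_iff)

lemma wclass_finite: "x \<in> wclass p k \<Longrightarrow> finite (cuts x)"
  by (auto simp: wclass_iff adm_def)

lemma wclass_depends: "x \<in> wclass p k \<Longrightarrow> depends (Max (cuts x)) (region x)"
  by (auto simp: wclass_iff adm_def)

lemma wt_wclass_ge: "x \<in> wclass p k \<Longrightarrow> (1 / 2) ^ level x \<le> wt x"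
  unfolding wt_def by (intro weight_ge) (auto simp: wclass_card wclass_iff adm_def)

lemma wt_wclass_min_card: "x \<in> wclass p k \<Longrightarrow> wt x < 16 \<Longrightarrow> min_card (level x) < card (cuts x)"
  unfolding wt_def by (intro card_gt_min_card) (auto simp: wclass_card)

section \<open>Traces in windows of coordinates\<close>

lemma thin_localize:
  assumes "thin D m n E" "depends b E" "m0 \<le> m" "n \<le> N" "m < n"
  shows "thin D m n (cyl_hull N {z. graft m0 a0 z \<in> E})"
  unfolding thin_def
proof
  fix a
  obtain C where C: "depends n C" "\<forall>z\<in>C. graft m (graft m0 a0 a) z \<notin> E" "big D 1 C"
    using assms(1) by (auto simp: thin_def)
  have "graft m a z \<notin> cyl_hull N {z. graft m0 a0 z \<in> E}" if z: "z \<in> C" for z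
  proof
    assume "graft m a z \<in> cyl_hull N {z. graft m0 a0 z \<in> E}"
    then obtain e where e: "agree N (graft m a z) e" "graft m0 a0 e \<in> E" by (auto simp: cyl_hull_def)
    \<comment> \<open>\<open>y\<close> has the coordinates of \<open>z\<close> below
      \<open>N\<close>, hence stays in \<open>C\<close>, and continues like \<open>e\<close>. Thus
      the set \<open>C\<close> found for the cylinder of \<open>graft m0 a0 a\<close> also serves
      the trace in the cylinder of \<open>a\<close>.\<close>
    define y where "y = graft N z e"
    have "agree n z y"
      using assms(4) by (auto simp: y_def agree_def graft_def)
    then have y: "y \<in> C" using C(1) z by (auto intro: depD)
    have "agree b (graft m0 a0 e) (graft m (graft m0 a0 a) y)"
      using e(1) assms(3-5) by (auto simp: agree_def y_def graft_def)
    then have "graft m (graft m0 a0 a) y \<in> E"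
      using depD[OF assms(2) _ e(2)] by blast
    with C(2) y show False by blast
  qed
  with C show "\<exists>C. depends n C \<and> (\<forall>z\<in>C. graft m a z \<notin> cyl_hull N {z. graft m0 a0 z \<in> E}) \<and> big D 1 C"
    by blast
qed

lemma adm_localize:
  assumes "adm D x" "cuts x \<inter> {m..<n} \<noteq> {}"
  shows "adm D (localize m n a x)"
proof -
  have fin: "finite (cuts x \<inter> {m..<n})"
    using assms(1) by (simp add: adm_def)
  then have "card (cuts x \<inter> {m..<n}) \<le> card (cuts x)"
    using assms(1) by (intro card_mono) (auto simp: adm_def)
  moreover have "card (cuts x) \<le> max_card (level x)"
    using assms(1) by (simp add: adm_def)
  ultimately have "card (cuts x \<inter> {m..<n}) \<le> max_card (level x)" by linarith
  moreover have "thin D m' n' (cyl_hull (Max (cuts x \<inter> {m..<n})) {z. graft m a z \<in> region x})"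
    if "m' \<in> cuts x \<inter> {m..<n}" "n' \<in> cuts x \<inter> {m..<n}" "m' < n'" for m' n'
    using assms(1) that fin by (intro thin_localize) (auto simp: adm_def)
  ultimately show ?thesis
    using assms(2) fin by (auto simp: adm_def localize_def depends_cyl_hull)
qed

lemma level_localize [simp]: "level (localize m n a x) = level x"
  by (simp add: localize_def)

lemma localize_wclass: "x \<in> wclass p k \<Longrightarrow> cuts x \<inter> {m..<n} \<noteq> {} \<Longrightarrow> localize m n a x \<in> wclass p k"
  unfolding wclass_iff level_localize using adm_localize by blast

lemma agree_graft_iff:
  assumes "m \<le> n"
  shows "agree n (graft m a z) w \<longleftrightarrow>
    agree m a w \<and> (\<forall>i. m \<le> i \<longrightarrow> i < n \<longrightarrow> z i mod Suc i = w i mod Suc i)"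
proof -
  have "(i < n \<longrightarrow> graft m a z i mod Suc i = w i mod Suc i) \<longleftrightarrow>
      (i < m \<longrightarrow> a i mod Suc i = w i mod Suc i) \<and>
      (m \<le> i \<longrightarrow> i < n \<longrightarrow> z i mod Suc i = w i mod Suc i)" for i
    using assms by (cases "i < m") (simp_all add: graft_def)
  then show ?thesis unfolding agree_def by blast
qed

text \<open>Traces of total weight less than \<open>c\<close> cannot cover \<open>C\<close>. A point
  of \<open>C\<close> that they miss, placed after the first \<open>m\<close> coordinates of
  \<open>a\<close>, avoids \<open>F\<close> however it is continued from \<open>n\<close> on, since
  each trace is a hull over coordinates below \<open>n\<close>.\<close>

lemma window_step:
  assumes F: "finite F" "F \<subseteq> wclass p k" and C: "big (wclass p k) c C" and "m \<le> n"
    and ne: "\<And>x. x \<in> F \<Longrightarrow> cuts x \<inter> {m..<n} \<noteq> {}"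
    and less: "(\<Sum>x\<in>F. wt (localize m n a x)) < c"
  obtains z where "z \<in> C" "\<And>x w. x \<in> F \<Longrightarrow> agree n (graft m a z) w \<Longrightarrow> w \<notin> region x"
proof -
  have "sum wt (localize m n a ` F) \<le> (\<Sum>x\<in>F. wt (localize m n a x))"
    using sum_image_le[OF F(1), of wt "localize m n a"] by (simp add: comp_def)
  with less have "sum wt (localize m n a ` F) < c" by linarith
  moreover have "localize m n a ` F \<subseteq> wclass p k"
    using F(2) ne by (auto intro!: localize_wclass)
  ultimately have "\<not> C \<subseteq> (\<Union>x\<in>localize m n a ` F. region x)"
    using bigD[OF C, of "localize m n a ` F"] F(1) by auto
  then obtain z where z: "z \<in> C" "\<And>x. x \<in> F \<Longrightarrow> z \<notin> region (localize m n a x)" by auto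
  have "w \<notin> region x" if x: "x \<in> F" and w: "agree n (graft m a z) w" for x w
  proof
    assume "w \<in> region x"
    moreover have "w i mod Suc i = a i mod Suc i" if "i < m" for i
      using w[unfolded agree_graft_iff[OF \<open>m \<le> n\<close>]] that by (simp add: agree_def)
    then have "agree b w (graft m a w)" for b
      by (auto simp: agree_def graft_def)
    ultimately have "graft m a w \<in> region x"
      using F(2) x wclass_depends depD by blast
    \<comment> \<open>With the coordinates of \<open>z\<close> below \<open>m\<close> and those of
      \<open>w\<close> afterwards, this point of the pulled-back region agrees with \<open>z\<close>
      below \<open>n\<close> and so puts \<open>z\<close> into the hull.\<close>
    then have "graft m z w \<in> {z. graft m a z \<in> region x}" by simp
    moreover have "Max (cuts x \<inter> {m..<n}) < n"
      using Max_in[of "cuts x \<inter> {m..<n}"] ne[OF x] F(2) x wclass_finite by auto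
    then have "agree (Max (cuts x \<inter> {m..<n})) z (graft m z w)"
      using w[unfolded agree_graft_iff[OF \<open>m \<le> n\<close>]] by (simp add: agree_def graft_def)
    ultimately have "z \<in> region (localize m n a x)"
      by (auto simp: localize_def cyl_hull_def intro!: exI[of _ "graft m z w"])
    with z(2) x show False by blast
  qed
  with z(1) that show thesis by blast
qed

text \<open>\<open>C\<close> sees only the first \<open>n\<close> coordinates, so the avoidance of
  \<open>E\<close> survives any continuation of the point beyond \<open>n\<close>.\<close>

lemma thin_avoid:
  assumes "depends b E" "depends n C" "z \<in> C" "\<And>z. z \<in> C \<Longrightarrow> graft m a z \<notin> E" "m \<le> n" "agree n (graft m a z) w"
  shows "w \<notin> E"
proof
  assume w: "w \<in> E"
  have "agree n z (graft n z w)" by (simp add: agree_graft)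
  then have "graft n z w \<in> C" using assms(2,3) depD by blast
  moreover have "agree b w (graft m a (graft n z w))"
    using assms(5,6) by (auto simp: agree_def graft_def)
  then have "graft m a (graft n z w) \<in> E" using assms(1) w depD by blast
  ultimately show False using assms(4) by blast
qed

lemma card_Int_atLeastLessThan_add:
  assumes "finite A" "(a::nat) \<le> b" "b \<le> c"
  shows "card (A \<inter> {a..<c}) = card (A \<inter> {a..<b}) + card (A \<inter> {b..<c})"
proof -
  have "A \<inter> {a..<c} = (A \<inter> {a..<b}) \<union> (A \<inter> {b..<c})"
    using assms(2,3) by auto
  then show ?thesis
    using assms(1) by (simp add: card_Un_disjoint disjoint_iff)
qed

text \<open>The members that keep enough cuts in the window for their traces to be only slightly
  heavier than they are, so that \<open>window_step\<close> can avoid them there.\<close>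

definition heavy :: "nat \<Rightarrow> wset set \<Rightarrow> nat \<Rightarrow> nat \<Rightarrow> wset set" where
  "heavy Q F m n = {x \<in> F. card (cuts x) \<le> Q * card (cuts x \<inter> {m..<n})}"

text \<open>
  An element of \<open>F\<close> is heavy in at most \<open>Q\<close> of the disjoint windows cut out by \<open>J\<close>, so on average
  the windows carry little heavy weight.
\<close>

lemma light_window:
  assumes F: "finite F" "\<And>x. x \<in> F \<Longrightarrow> 0 < card (cuts x)"
    and t: "2 * Q * sum wt F < real t" and J: "finite J" "t < card J"
  obtains m n where "m \<in> J" "n \<in> J" "m < n" "sum wt (heavy Q F m n) < 1 / 2"
proof -
  \<comment> \<open>\<open>e\<close> lists \<open>J\<close> in increasing order. Since
    \<open>t < card J\<close>, there are \<open>t\<close> windows between consecutive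
    elements.\<close>
  define e where "e i = sorted_list_of_set J ! i" for i
  have e_in: "e i \<in> J" if "i < card J" for i
    using that J(1) nth_mem[of i "sorted_list_of_set J"] by (simp add: e_def)
  have e_less: "e i < e j" if "i < j" "j < card J" for i j
    using that sorted_wrt_nth_less[OF strict_sorted_list_of_set[of J]] by (simp add: e_def)
  let ?w = "\<lambda>i. {e i..<e (Suc i)}"
  have count: "card {i\<in>{..<t}. x \<in> heavy Q F (e i) (e (Suc i))} \<le> Q" if x: "x \<in> F" for x
  proof -
    have fin: "finite (cuts x)"
      using F(2)[OF x] card_gt_0_iff by blast
    have disj: "?w i \<inter> ?w j = {}" if "i < t" "j < t" "i \<noteq> j" for i j
    proof -
      have "?w i \<inter> ?w j = {}" if "i < j" "j < t" for i j
      proof -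
        have "e (Suc i) \<le> e j"
          using that J(2) e_less[of "Suc i" j] by (cases "Suc i = j") auto
        then show ?thesis by auto
      qed
      with that show ?thesis by (metis Int_commute nat_neq_iff)
    qed
    let ?S = "{i\<in>{..<t}. x \<in> heavy Q F (e i) (e (Suc i))}"
    have "card ?S * card (cuts x) = (\<Sum>i\<in>?S. card (cuts x))" by simp
    also have "\<dots> \<le> (\<Sum>i\<in>?S. Q * card (cuts x \<inter> ?w i))"
      by (intro sum_mono) (auto simp: heavy_def)
    also have "\<dots> = Q * card (\<Union>i\<in>?S. cuts x \<inter> ?w i)"
    proof -
      have "card (\<Union>i\<in>?S. cuts x \<inter> ?w i) = (\<Sum>i\<in>?S. card (cuts x \<inter> ?w i))"
        using fin by (intro card_UN_disjoint) (simp_all, use disj in blast)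
      then show ?thesis by (simp only: sum_distrib_left)
    qed
    also have "\<dots> \<le> Q * card (cuts x)"
      using fin by (intro mult_le_mono2 card_mono) auto
    finally show ?thesis using F(2)[OF x] by simp
  qed
  have "\<exists>i<t. sum wt (heavy Q F (e i) (e (Suc i))) < 1 / 2"
  proof (rule ccontr)
    \<comment> \<open>Double counting: otherwise \<open>t / 2\<close> is at most the sum of the
      heavy weights over all windows, hence at most \<open>Q * sum wt F\<close>, against the choice
      of \<open>t\<close>.\<close>
    assume "\<not> ?thesis"
    then have "(\<Sum>i<t. 1 / 2) \<le> (\<Sum>i<t. sum wt (heavy Q F (e i) (e (Suc i))))"
      by (intro sum_mono) (metis lessThan_iff not_less)
    also have "\<dots> = (\<Sum>i<t. \<Sum>x\<in>F. if x \<in> heavy Q F (e i) (e (Suc i)) then wt x else 0)"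
    proof (rule sum.cong[OF refl])
      fix i
      have "F \<inter> heavy Q F (e i) (e (Suc i)) = heavy Q F (e i) (e (Suc i))"
        by (auto simp: heavy_def)
      then show "sum wt (heavy Q F (e i) (e (Suc i))) =
          (\<Sum>x\<in>F. if x \<in> heavy Q F (e i) (e (Suc i)) then wt x else 0)"
        using sum.inter_restrict[OF F(1), of wt "heavy Q F (e i) (e (Suc i))"] by simp
    qed
    also have "\<dots> = (\<Sum>x\<in>F. \<Sum>i<t. if x \<in> heavy Q F (e i) (e (Suc i)) then wt x else 0)"
      by (rule sum.swap)
    also have "\<dots> = (\<Sum>x\<in>F. card {i\<in>{..<t}. x \<in> heavy Q F (e i) (e (Suc i))} * wt x)"
    proof (rule sum.cong[OF refl])
      fix x
      let ?P = "\<lambda>i. x \<in> heavy Q F (e i) (e (Suc i))"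
      have "(\<Sum>i<t. if ?P i then wt x else 0) = (\<Sum>i\<in>{i\<in>{..<t}. ?P i}. wt x)"
        by (rule sum.inter_filter[symmetric]) simp
      then show "(\<Sum>i<t. if ?P i then wt x else 0) = card {i\<in>{..<t}. ?P i} * wt x"
        by simp
    qed
    also have "\<dots> \<le> (\<Sum>x\<in>F. Q * wt x)"
      by (intro sum_mono mult_right_mono) (simp_all only: of_nat_le_iff count wt_nonneg)
    also have "\<dots> = Q * sum wt F" by (simp add: sum_distrib_left)
    finally show False using t by simp
  qed
  then obtain i where "i < t" "sum wt (heavy Q F (e i) (e (Suc i))) < 1 / 2" by blast
  with J(2) show thesis
    by (intro that[of "e i" "e (Suc i)"] e_in e_less) auto
qed

text \<open>
  The members of \<open>G\<close> are avoided one by one, each in a light window \<open>{m..<n}\<close> between two of its own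
  cuts. This splits \<open>{u..<N}\<close> into \<open>2 * card G + 1\<close> windows, and each member of \<open>F\<close> is heavy in one of
  them, where it is avoided as well.
\<close>

lemma greedy:
  assumes F: "finite F" "F \<subseteq> wclass p K" and full: "big (wclass p K) c UNIV"
    and r: "r * sum wt F < c" "0 < r" "r \<le> 2"
    and shrink: "\<And>x j. x \<in> F \<Longrightarrow> 0 < j \<Longrightarrow> card (cuts x) \<le> Q * j \<Longrightarrow> weight (level x) j \<le> r * wt x"
    and FN: "\<And>x. x \<in> F \<Longrightarrow> cuts x \<subseteq> {..<N}"
    and t: "2 * Q * sum wt F < real t"
    and G: "finite G" "\<And>x. x \<in> G \<Longrightarrow> adm (wclass p K) x" "\<And>x. x \<in> G \<Longrightarrow> cuts x \<subseteq> {..<N}"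
    and card: "\<And>x. x \<in> G \<Longrightarrow> card G * (t + 1) \<le> card (cuts x \<inter> {u..<N})"
    and "u \<le> N"
  shows "\<exists>z. agree u a z \<and> (\<forall>x\<in>G. z \<notin> region x) \<and>
    (\<forall>x\<in>F. card (cuts x) * (2 * card G + 1) \<le> Q * card (cuts x \<inter> {u..<N}) \<longrightarrow> z \<notin> region x)"
  using G card \<open>u \<le> N\<close>
proof (induction "card G" arbitrary: G u a)
  have window: "\<exists>z\<in>C. \<forall>x\<in>heavy Q F m n. \<forall>w. agree n (graft m a z) w \<longrightarrow> w \<notin> region x"
    if "big (wclass p K) c' C" "m \<le> n" "r * sum wt (heavy Q F m n) < c'" for c' C m n a
  proof -
    have fin: "finite (heavy Q F m n)" and sub: "heavy Q F m n \<subseteq> F"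
      using F(1) by (auto simp: heavy_def)
    have ne: "cuts x \<inter> {m..<n} \<noteq> {}" if "x \<in> heavy Q F m n" for x
    proof
      assume "cuts x \<inter> {m..<n} = {}"
      with that have "card (cuts x) = 0" by (simp add: heavy_def)
      moreover have "0 < card (cuts x)" using that sub F(2) wclass_card by blast
      ultimately show False by simp
    qed
    have "wt (localize m n a x) \<le> r * wt x" if x: "x \<in> heavy Q F m n" for x
    proof -
      have "x \<in> F" using x sub by blast
      then have "0 < card (cuts x \<inter> {m..<n})"
        using ne[OF x] F(2) wclass_finite by (auto simp: card_gt_0_iff)
      with \<open>x \<in> F\<close> x show ?thesis
        unfolding wt_def[of "localize m n a x"] by (auto simp: localize_def heavy_def intro!: shrink)
    qed
    then have "(\<Sum>x\<in>heavy Q F m n. wt (localize m n a x)) \<le> r * sum wt (heavy Q F m n)"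
      unfolding sum_distrib_left by (intro sum_mono)
    with that(3) have "(\<Sum>x\<in>heavy Q F m n. wt (localize m n a x)) < c'" by linarith
    from window_step[OF fin _ that(1,2) ne this] sub F(2) show ?thesis
      by (metis subset_trans)
  qed
  have window_UNIV: "\<exists>z. \<forall>x\<in>heavy Q F m n. \<forall>w. agree n (graft m a z) w \<longrightarrow> w \<notin> region x"
    if "m \<le> n" for m n a
  proof -
    have "sum wt (heavy Q F m n) \<le> sum wt F"
      using F(1) by (intro sum_mono2) (auto simp: heavy_def)
    then have "r * sum wt (heavy Q F m n) \<le> r * sum wt F"
      using r(2) by (intro mult_left_mono) auto
    with r(1) have "r * sum wt (heavy Q F m n) < c" by linarith
    from window[OF full that this] show ?thesis by blast
  qed
  {
    case 0
    then have "G = {}" by simp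
    from window_UNIV[OF \<open>u \<le> N\<close>, of a] obtain z
      where z: "\<forall>x\<in>heavy Q F u N. \<forall>w. agree N (graft u a z) w \<longrightarrow> w \<notin> region x" by blast
    have "graft u a z \<notin> region x" if "x \<in> F" "card (cuts x) \<le> Q * card (cuts x \<inter> {u..<N})" for x
      using z[rule_format, OF _ agree_refl] that by (simp add: heavy_def)
    then show ?case
      unfolding \<open>G = {}\<close> by (intro exI[of _ "graft u a z"]) simp
  next
    case (Suc g)
    define P where "P v \<longleftrightarrow> (\<exists>x\<in>G. t + 1 \<le> card (cuts x \<inter> {u..<v}))" for v
    have fin: "finite (cuts x)" if "x \<in> G" for x
      using Suc.prems(2)[OF that] by (simp add: adm_def)
    from Suc.hyps(2) have "G \<noteq> {}" by auto
    then have PN: "P N"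
      using Suc.prems(4) Suc.hyps(2)[symmetric] by (fastforce simp: P_def)
    \<comment> \<open>The first place where some \<open>x\<close> in \<open>G\<close> has seen
      \<open>t + 1\<close> cuts. By minimality every other member has spent at most
      \<open>t + 1\<close> cuts so far, and keeps enough for the induction.\<close>
    define v where "v = (LEAST v. P v)"
    have "P v" "v \<le> N"
      unfolding v_def using PN by (auto intro: LeastI Least_le)
    then obtain x where x: "x \<in> G" "t < card (cuts x \<inter> {u..<v})" by (auto simp: P_def)
    have early: "card (cuts y \<inter> {u..<v}) \<le> t + 1" if "y \<in> G" for y
    proof -
      have "0 < v" using x(2) by (intro Nat.gr0I) auto
      then have "\<not> P (v - 1)" unfolding v_def by (intro not_less_Least) auto
      with that have *: "card (cuts y \<inter> {u..<v - 1}) \<le> t" by (auto simp: P_def not_le)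
      have "cuts y \<inter> {u..<v} \<subseteq> insert (v - 1) (cuts y \<inter> {u..<v - 1})" by auto
      then have "card (cuts y \<inter> {u..<v}) \<le> card (insert (v - 1) (cuts y \<inter> {u..<v - 1}))"
        using fin[OF that] by (intro card_mono) auto
      also have "\<dots> \<le> Suc (card (cuts y \<inter> {u..<v - 1}))" by (rule card_insert_le_m1) auto
      finally show ?thesis using * by simp
    qed
    obtain m n where mn: "m \<in> cuts x \<inter> {u..<v}" "n \<in> cuts x \<inter> {u..<v}" "m < n"
      "sum wt (heavy Q F m n) < 1 / 2"
      using light_window[OF F(1) _ t _ x(2)] F(2) wclass_card fin[OF x(1)] by blast
    then have "u \<le> m" "n < v" by auto
    \<comment> \<open>Coordinates are now chosen from left to right: \<open>z1\<close> fills
      \<open>{u..<m}\<close>, then a point of the set \<open>C\<close> given by thinness fills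
      \<open>{m..<n}\<close>, and the induction hypothesis does the rest.\<close>
    obtain z1 where z1: "\<And>y w. y \<in> heavy Q F u m \<Longrightarrow> agree m (graft u a z1) w \<Longrightarrow> w \<notin> region y"
      using window_UNIV[OF \<open>u \<le> m\<close>, of a] by blast
    define a1 where "a1 = graft u a z1"
    obtain C where C: "depends n C" "\<And>z. z \<in> C \<Longrightarrow> graft m a1 z \<notin> region x" "big (wclass p K) 1 C"
      using Suc.prems(2)[OF x(1)] mn unfolding adm_def thin_def by blast
    \<comment> \<open>\<open>C\<close> is only known to have submeasure at least 1. With
      \<open>r \<le> 2\<close>, heavy weight below 1/2 is exactly what this permits.\<close>
    have "r * sum wt (heavy Q F m n) \<le> 2 * sum wt (heavy Q F m n)"
      using r(3) by (intro mult_right_mono) (auto intro: sum_nonneg)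
    with mn(4) have "r * sum wt (heavy Q F m n) < 1" by linarith
    with window[OF C(3)] \<open>m < n\<close> obtain z2 where z2: "z2 \<in> C"
      "\<And>y w. y \<in> heavy Q F m n \<Longrightarrow> agree n (graft m a1 z2) w \<Longrightarrow> w \<notin> region y"
      by (meson less_imp_le)
    define a2 where "a2 = graft m a1 z2"
    have card_G': "card (G - {x}) = g"
      using Suc.hyps(2) Suc.prems(1) x(1) by simp
    have card': "card (G - {x}) * (t + 1) \<le> card (cuts y \<inter> {n..<N})" if "y \<in> G - {x}" for y
    proof -
      have "card (cuts y \<inter> {u..<N}) = card (cuts y \<inter> {u..<v}) + card (cuts y \<inter> {v..<N})"
        using that fin \<open>v \<le> N\<close> \<open>u \<le> m\<close> \<open>m < n\<close> \<open>n < v\<close> by (intro card_Int_atLeastLessThan_add) auto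
      moreover have "card (cuts y \<inter> {v..<N}) \<le> card (cuts y \<inter> {n..<N})"
        using that fin \<open>n < v\<close> by (intro card_mono) auto
      moreover have "card G * (t + 1) = (t + 1) + g * (t + 1)"
        using Suc.hyps(2)[symmetric] by simp
      ultimately show ?thesis
        using early[of y] Suc.prems(4)[of y] that card_G' by simp
    qed
    have "n \<le> N" using \<open>n < v\<close> \<open>v \<le> N\<close> by simp
    obtain z where z: "agree n a2 z" "\<And>y. y \<in> G - {x} \<Longrightarrow> z \<notin> region y"
      "\<And>y. y \<in> F \<Longrightarrow> card (cuts y) * (2 * card (G - {x}) + 1) \<le> Q * card (cuts y \<inter> {n..<N}) \<Longrightarrow> z \<notin> region y"
    proof -
      have "finite (G - {x})" "\<And>y. y \<in> G - {x} \<Longrightarrow> adm (wclass p K) y"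
        "\<And>y. y \<in> G - {x} \<Longrightarrow> cuts y \<subseteq> {..<N}"
        using Suc.prems(1-3) by blast+
      from Suc.hyps(1)[OF card_G'[symmetric] this card' \<open>n \<le> N\<close>, of a2] that show thesis
        by blast
    qed
    have zm: "agree m a1 z"
      using z(1) \<open>m < n\<close> unfolding a2_def by (simp add: agree_graft_iff)
    then have zu: "agree u a z"
      using \<open>u \<le> m\<close> unfolding a1_def by (simp add: agree_graft_iff)
    have "depends (Max (cuts x)) (region x)"
      using Suc.prems(2)[OF x(1)] by (simp add: adm_def)
    then have zx: "z \<notin> region x"
      using thin_avoid[OF _ C(1) z2(1) C(2)] z(1) \<open>m < n\<close> unfolding a2_def by auto
    have zF: "z \<notin> region y"
      if y: "y \<in> F" and le: "card (cuts y) * (2 * card G + 1) \<le> Q * card (cuts y \<inter> {u..<N})" for y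
    proof (cases "y \<in> heavy Q F u m \<or> y \<in> heavy Q F m n")
      case True
      then show ?thesis
        using z1[of y z] zm z2(2)[of y z] z(1) unfolding a1_def a2_def by blast
    next
      case False
      have "finite (cuts y)" using y F(2) wclass_finite by blast
      then have "card (cuts y \<inter> {u..<N}) =
          card (cuts y \<inter> {u..<m}) + card (cuts y \<inter> {m..<n}) + card (cuts y \<inter> {n..<N})"
        using \<open>u \<le> m\<close> \<open>m < n\<close> \<open>n \<le> N\<close> card_Int_atLeastLessThan_add[of "cuts y" u m N]
          card_Int_atLeastLessThan_add[of "cuts y" m n N] by simp
      then have "Q * card (cuts y \<inter> {u..<N}) = Q * card (cuts y \<inter> {u..<m}) +
          Q * card (cuts y \<inter> {m..<n}) + Q * card (cuts y \<inter> {n..<N})"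
        by (simp add: distrib_left)
      moreover have "Q * card (cuts y \<inter> {u..<m}) < card (cuts y)" "Q * card (cuts y \<inter> {m..<n}) < card (cuts y)"
        using False y by (auto simp: heavy_def not_le)
      moreover have "card (cuts y) * (2 * card G + 1) = 2 * card (cuts y) + card (cuts y) * (2 * g + 1)"
        using Suc.hyps(2)[symmetric] by (simp add: algebra_simps)
      \<comment> \<open>Heavy in neither \<open>{u..<m}\<close> nor \<open>{m..<n}\<close>,
        \<open>y\<close> loses fewer than \<open>card (cuts y) / Q\<close> cuts in each. These two
        windows account for the drop from \<open>2 * card G + 1\<close> to
        \<open>2 * g + 1\<close>.\<close>
      ultimately have "card (cuts y) * (2 * g + 1) \<le> Q * card (cuts y \<inter> {n..<N})"
        using le by linarith
      then show ?thesis using z(3)[OF y] card_G' by simp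
    qed
    from zu zx z(2) zF show ?case by blast
  }
qed

text \<open>Downward induction on \<open>k\<close>; from the cut-off on the class is empty and
  covers nothing. In a cover of weight below \<open>level_bound k\<close>, the members of level
  \<open>k\<close> weigh at least \<open>(1 / 2) ^ k\<close> each, so there are fewer than
  \<open>2 ^ (k + 4)\<close> of them, and weight below 16 gives each more than
  \<open>min_card k\<close> cuts. Then \<open>greedy\<close> produces an uncovered point.\<close>

theorem big_UNIV: "big (wclass p k) (level_bound k) UNIV"
proof (induction "p - k" arbitrary: k)
  case 0
  then show ?case by (simp add: wclass_ge big_def)
next
  case (Suc j)
  then have "k < p" and IH: "big (wclass p (Suc k)) (level_bound (Suc k)) UNIV" by auto
  show ?case
    unfolding big_def
  proof (intro allI impI)
    fix F assume F: "finite F" "F \<subseteq> wclass p k" "UNIV \<subseteq> (\<Union>x\<in>F. region x)"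
    show "level_bound k \<le> sum wt F"
    proof (rule ccontr)
      assume "\<not> level_bound k \<le> sum wt F"
      then have less: "sum wt F < level_bound k" by simp
      then have less16: "sum wt F < 16" using level_bound_bounds(2)[of k] by linarith
      define G where "G = {x\<in>F. level x = k}"
      define F' where "F' = {x\<in>F. level x \<noteq> k}"
      \<comment> \<open>\<open>Q\<close> exceeds the number \<open>2 * card G + 1\<close> of
        windows, so every member of \<open>F'\<close> passes the heaviness test of
        \<open>greedy\<close>. The factor 32 in \<open>t\<close> is twice the bound 16 on the total
        weight.\<close>
      define Q :: nat where "Q = 2 ^ (k + 6)"
      define t where "t = 32 * Q"
      define N where "N = Suc (Max (insert 0 (\<Union>x\<in>F. cuts x)))"
      have fin: "finite (\<Union>x\<in>F. cuts x)" using F(1,2) wclass_finite by blast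
      have N: "cuts x \<subseteq> {..<N}" if "x \<in> F" for x
      proof
        fix i assume "i \<in> cuts x"
        then have "i \<le> Max (insert 0 (\<Union>x\<in>F. cuts x))"
          using fin that by (intro Max_ge) auto
        then show "i \<in> {..<N}" by (simp add: N_def)
      qed
      have F': "finite F'" "F' \<subseteq> wclass p (Suc k)"
        using F(1,2) by (auto simp: F'_def wclass_less[OF \<open>k < p\<close>])
      have G': "adm (wclass p (Suc k)) x" if "x \<in> G" for x
        using F(2) that wclass_iff[of x p k] by (auto simp: G_def)
      have "sum wt F' \<le> sum wt F"
        using F(1) by (intro sum_mono2) (auto simp: F'_def)
      with less have less': "sum wt F' < level_bound k" by linarith
      have finG: "finite G" using F(1) by (simp add: G_def)
      have "card G * (1 / 2) ^ k = (\<Sum>x\<in>G. (1 / 2) ^ k)" by simp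
      also have "\<dots> \<le> sum wt G"
        using F(2) wt_wclass_ge by (intro sum_mono) (force simp: G_def)
      also have "\<dots> \<le> sum wt F"
        using F(1) by (intro sum_mono2) (auto simp: G_def)
      finally have "real (card G) * (1 / 2) ^ k < 16" using less16 by linarith
      then have "real (card G) < 16 * 2 ^ k" by (simp add: power_one_over field_simps)
      then have "real (card G) < real (2 ^ (k + 4))" by (simp add: power_add)
      then have cardG: "card G < 2 ^ (k + 4)" by linarith
      have big_cuts: "card G * (t + 1) \<le> card (cuts x \<inter> {0..<N})" if "x \<in> G" for x
      proof -
        have x: "x \<in> F" "level x = k" using that by (auto simp: G_def)
        have "wt x \<le> sum wt F" using x(1) F(1) by (intro member_le_sum) auto
        then have "min_card k < card (cuts x)"
          using wt_wclass_min_card[of x p k] x F(2) less16 by auto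
        moreover have "card G * (t + 1) \<le> min_card k"
          unfolding min_card_def t_def Q_def using cardG by (intro mult_le_mono) auto
        moreover have "cuts x \<inter> {0..<N} = cuts x" using N[OF x(1)] by auto
        ultimately show ?thesis by simp
      qed
      define r :: real where "r = 1 + 1 / 2 ^ (k + 2)"
      have "1 / 2 ^ (k + 2) \<le> (1::real)"
        using one_le_power[of "2::real" "k + 2"] by (simp add: divide_le_eq)
      then have r: "0 < r" "r \<le> 2"
        unfolding r_def by (auto intro: add_pos_pos)
      have t: "2 * real Q * sum wt F' < real t"
        using less' level_bound_bounds(2)[of k] by (simp add: t_def Q_def)
      have "r * sum wt F' < r * level_bound k"
        using less' r(1) by (rule mult_strict_left_mono)
      with level_bound_Suc[of k] have rF': "r * sum wt F' < level_bound (Suc k)" by (simp add: r_def)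
      have shrink: "weight (level x) j \<le> r * wt x" if "x \<in> F'" "0 < j" "card (cuts x) \<le> Q * j" for x j
      proof -
        have "x \<in> wclass p (Suc k)" using that F' by blast
        then have "k < level x" "0 < card (cuts x)"
          using wclass_card[of x p "Suc k"] wclass_iff[of x p "Suc k"] by auto
        with that show ?thesis
          unfolding wt_def r_def by (intro weight_shrink_less) (simp_all add: Q_def)
      qed
      have NF': "cuts x \<subseteq> {..<N}" if "x \<in> F'" for x
        using N[of x] that by (simp add: F'_def)
      have NG: "cuts x \<subseteq> {..<N}" if "x \<in> G" for x
        using N[of x] that by (simp add: G_def)
      obtain z where z: "\<forall>x\<in>G. z \<notin> region x"
        "\<forall>x\<in>F'. card (cuts x) * (2 * card G + 1) \<le> Q * card (cuts x \<inter> {0..<N}) \<longrightarrow> z \<notin> region x"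
        using greedy[OF F' IH rF' r shrink NF' t finG G' NG big_cuts] by blast
      have "z \<notin> region x" if "x \<in> F'" for x
      proof -
        have "cuts x \<inter> {0..<N} = cuts x" using N[of x] that by (auto simp: F'_def)
        moreover have "2 * card G + 1 \<le> Q" using cardG by (simp add: Q_def power_add)
        then have "card (cuts x) * (2 * card G + 1) \<le> card (cuts x) * Q" by (rule mult_le_mono2)
        ultimately show ?thesis using z(2) that by (simp add: mult.commute)
      qed
      moreover have "F = G \<union> F'" by (auto simp: G_def F'_def)
      ultimately have "z \<notin> region x" if "x \<in> F" for x
        using z(1) that by blast
      with F(3) show False by blast
    qed
  qed
qed

section \<open>Localising covers\<close>

lemma index_bound:
  assumes "finite F" "F \<subseteq> wclass p k"
  obtains N where "n \<le> N" "\<And>x. x \<in> F \<Longrightarrow> cuts x \<subseteq> {..<N}"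
proof
  let ?U = "insert n (\<Union>x\<in>F. cuts x)"
  have fin: "finite ?U" using assms wclass_finite by blast
  show "n \<le> Suc (Max ?U)"
    using Max_ge[OF fin, of n] by simp
  show "cuts x \<subseteq> {..<Suc (Max ?U)}" if "x \<in> F" for x
  proof
    fix i assume "i \<in> cuts x"
    then have "i \<le> Max ?U"
      using fin that by (intro Max_ge) auto
    then show "i \<in> {..<Suc (Max ?U)}" by simp
  qed
qed

lemma localize_third:
  assumes "x \<in> wclass p k" "card (cuts x) \<le> 3 * card (cuts x \<inter> {m..<n})"
  shows "cuts x \<inter> {m..<n} \<noteq> {}" "wt (localize m n a x) \<le> 2 * wt x"
proof -
  have "0 < card (cuts x)" using assms(1) wclass_card by blast
  with assms(2) have *: "0 < card (cuts x \<inter> {m..<n})" by linarith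
  then show "cuts x \<inter> {m..<n} \<noteq> {}" by (metis card.empty less_irrefl)
  show "wt (localize m n a x) \<le> 2 * wt x"
    unfolding wt_def using weight_shrink3[OF * \<open>0 < card (cuts x)\<close> assms(2), of "level x"]
    by (simp add: localize_def)
qed

text \<open>Traces that keep a third of the cuts weigh at most twice as much, and twice 4 is within
  the bound 8 of \<open>big_UNIV\<close>.\<close>

lemma avoid_window:
  assumes F: "finite F" "F \<subseteq> wclass p k" "sum wt F < 4" and "m \<le> n"
    and third: "\<And>x. x \<in> F \<Longrightarrow> card (cuts x) \<le> 3 * card (cuts x \<inter> {m..<n})"
  obtains z where "\<And>x w. x \<in> F \<Longrightarrow> agree n (graft m a z) w \<Longrightarrow> w \<notin> region x"
proof -
  have ne: "cuts x \<inter> {m..<n} \<noteq> {}" if "x \<in> F" for x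
    using localize_third(1)[OF _ third[OF that]] F(2) that by blast
  have "(\<Sum>x\<in>F. wt (localize m n a x)) \<le> (\<Sum>x\<in>F. 2 * wt x)"
    using localize_third(2)[OF _ third] F(2) by (intro sum_mono) blast
  also have "\<dots> = 2 * sum wt F" by (simp add: sum_distrib_left)
  finally have "(\<Sum>x\<in>F. wt (localize m n a x)) < level_bound k"
    using F(3) level_bound_bounds(1)[of k] by linarith
  from F(1,2) big_UNIV \<open>m \<le> n\<close> ne this show thesis
  proof (rule window_step)
    fix z assume "\<And>x w. x \<in> F \<Longrightarrow> agree n (graft m a z) w \<Longrightarrow> w \<notin> region x"
    then show thesis by (rule that)
  qed
qed

text \<open>Prescribing coordinate \<open>n\<close> leaves the windows before and after it. A set of
  weight below 1 has more than 3 cuts, at most one of them at \<open>n\<close>, so it keeps a third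
  of its cuts in one of the two windows and is avoided there.\<close>

lemma big_coordinate:
  assumes "t \<le> n"
  shows "big (wclass p k) 1 {z. z n mod Suc n = t}"
  unfolding big_def
proof (intro allI impI)
  fix F assume F: "finite F" "F \<subseteq> wclass p k" "{z. z n mod Suc n = t} \<subseteq> (\<Union>x\<in>F. region x)"
  show "1 \<le> sum wt F"
  proof (rule ccontr)
    assume "\<not> 1 \<le> sum wt F"
    then have less: "sum wt F < 1" by simp
    obtain N where N: "Suc n \<le> N" "\<And>x. x \<in> F \<Longrightarrow> cuts x \<subseteq> {..<N}"
      using index_bound[OF F(1,2)] by blast
    define L where "L = {x \<in> F. card (cuts x) \<le> 3 * card (cuts x \<inter> {0..<n})}"
    define R where "R = {x \<in> F. card (cuts x) \<le> 3 * card (cuts x \<inter> {Suc n..<N})}"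
    have sub: "finite L" "finite R" "L \<subseteq> wclass p k" "R \<subseteq> wclass p k"
      using F(1,2) by (auto simp: L_def R_def)
    have "sum wt L \<le> sum wt F" "sum wt R \<le> sum wt F"
      using F(1) by (auto simp: L_def R_def intro!: sum_mono2)
    with less have less': "sum wt L < 4" "sum wt R < 4" by linarith+
    obtain z1 where z1: "\<And>x w. x \<in> L \<Longrightarrow> agree n z1 w \<Longrightarrow> w \<notin> region x"
      using avoid_window[OF sub(1,3) less'(1), of 0 n] by (auto simp: L_def)
    obtain z2 where z2: "\<And>x w. x \<in> R \<Longrightarrow> agree N (graft (Suc n) (z1(n := t)) z2) w \<Longrightarrow> w \<notin> region x"
      using avoid_window[OF sub(2,4) less'(2) N(1)] unfolding R_def by blast
    define w where "w = graft (Suc n) (z1(n := t)) z2"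
    have "w n mod Suc n = t" using assms by (simp add: w_def graft_def)
    then obtain x where x: "x \<in> F" "w \<in> region x" using F(3) by blast
    have "agree n z1 w" by (simp add: agree_def w_def graft_def)
    with z1 x(2) have "x \<notin> L" by blast
    moreover have "x \<notin> R" using z2[of x w] x(2) unfolding w_def by fastforce
    ultimately have "3 * card (cuts x \<inter> {0..<n}) < card (cuts x)"
      "3 * card (cuts x \<inter> {Suc n..<N}) < card (cuts x)"
      using x(1) by (auto simp: L_def R_def)
    moreover have "3 < card (cuts x)"
    proof -
      have "wt x \<le> sum wt F" using F(1) x(1) by (intro member_le_sum) auto
      then have "min_card (level x) < card (cuts x)"
        using wt_wclass_min_card[of x p k] F(2) x(1) less by auto
      with min_card_gt[of "level x"] show ?thesis by linarith
    qed
    moreover have "card (cuts x) \<le> card (cuts x \<inter> {0..<n}) + card (cuts x \<inter> {Suc n..<N}) + 1"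
    proof -
      have "cuts x \<subseteq> insert n ((cuts x \<inter> {0..<n}) \<union> (cuts x \<inter> {Suc n..<N}))"
        using N(2)[OF x(1)] by (auto simp: not_less Suc_le_eq)
      moreover have "finite (cuts x)" using F(2) x(1) wclass_finite by blast
      ultimately have "card (cuts x) \<le> card (insert n ((cuts x \<inter> {0..<n}) \<union> (cuts x \<inter> {Suc n..<N})))"
        by (intro card_mono) auto
      also have "\<dots> \<le> Suc (card ((cuts x \<inter> {0..<n}) \<union> (cuts x \<inter> {Suc n..<N})))"
        by (rule card_insert_le_m1) auto
      finally show ?thesis using card_Un_le[of "cuts x \<inter> {0..<n}" "cuts x \<inter> {Suc n..<N}"] by linarith
    qed
    ultimately show False by linarith
  qed
qed

text \<open>A finite stock of weighted sets. On it an ultrafilter limit of families coincides with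
  the families themselves for almost all indices.\<close>

definition boxed :: "nat \<Rightarrow> wset set" where
  "boxed N = {y. level y \<le> N \<and> depends N (region y) \<and> cuts y \<subseteq> {..<N}}"

lemma finite_boxed: "finite (boxed N)"
proof -
  have "boxed N \<subseteq> {..N} \<times> {Y. depends N Y} \<times> Pow {..<N}" by (auto simp: boxed_def)
  then show ?thesis by (rule finite_subset) (simp add: finite_depends)
qed

text \<open>
  The cover \<open>F'\<close> consists of traces in windows that start at \<open>m\<close> and end as soon as they contain a
  third of the cuts. It does not depend on \<open>N\<close>: whatever keeps a third of its cuts before \<open>m\<close> or
  beyond \<open>N\<close> can be avoided and is not needed to cover \<open>B\<close>.
\<close>

lemma window_cover:
  assumes F: "finite F" "F \<subseteq> wclass p k" "sum wt F < 1"
  obtains F' where "finite F'" "F' \<subseteq> wclass p k" "sum wt F' \<le> 2" "\<And>y. y \<in> F' \<Longrightarrow> tail_set m (region y)"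
    "\<And>N B. m \<le> N \<Longrightarrow> depends N B \<Longrightarrow> tail_set m B \<Longrightarrow> B \<subseteq> (\<Union>x\<in>F. region x) \<Longrightarrow> B \<subseteq> (\<Union>y\<in>F' \<inter> boxed N. region y)"
proof -
  define lower where "lower = {x \<in> F. card (cuts x) \<le> 3 * card (cuts x \<inter> {0..<m})}"
  define upper where "upper = {x \<in> F. \<exists>n. card (cuts x) \<le> 3 * card (cuts x \<inter> {m..<n})}"
  define nx where "nx x = (LEAST n. card (cuts x) \<le> 3 * card (cuts x \<inter> {m..<n}))" for x :: wset
  have nx: "card (cuts x) \<le> 3 * card (cuts x \<inter> {m..<nx x})" if "x \<in> upper" for x
    using that unfolding upper_def nx_def by (auto intro: LeastI)
  have fin: "finite lower" "finite upper" "lower \<subseteq> wclass p k" "upper \<subseteq> wclass p k" "upper \<subseteq> F"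
    using F(1,2) by (auto simp: lower_def upper_def)
  have "sum wt lower \<le> sum wt F" using F(1) by (intro sum_mono2) (auto simp: lower_def)
  with F(3) have low4: "sum wt lower < 4" by linarith
  obtain a where a: "\<And>x w. x \<in> lower \<Longrightarrow> agree m a w \<Longrightarrow> w \<notin> region x"
    using avoid_window[OF fin(1,3) low4, of 0 m] unfolding lower_def graft_0 by blast
  define h where "h x = localize m (nx x) a x" for x
  have upper_wclass: "x \<in> wclass p k" if "x \<in> upper" for x using that fin(4) by blast
  have h_wt: "wt (h x) \<le> 2 * wt x" if "x \<in> upper" for x
    unfolding h_def using localize_third(2)[OF upper_wclass nx] that by blast
  have h_wclass: "h x \<in> wclass p k" if "x \<in> upper" for x
    unfolding h_def using localize_third(1)[OF upper_wclass nx] upper_wclass that by (blast intro: localize_wclass)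
  have "sum wt (h ` upper) \<le> (\<Sum>x\<in>upper. wt (h x))"
    using sum_image_le[OF fin(2), of wt h] by (simp add: comp_def)
  also have "\<dots> \<le> (\<Sum>x\<in>upper. 2 * wt x)"
    by (intro sum_mono h_wt)
  also have "\<dots> \<le> (\<Sum>x\<in>F. 2 * wt x)"
    using F(1) fin(5) by (intro sum_mono2) auto
  also have "\<dots> = 2 * sum wt F" by (simp add: sum_distrib_left)
  finally have sum_h: "sum wt (h ` upper) \<le> 2" using F(3) by linarith
  have cover: "B \<subseteq> (\<Union>y\<in>h ` upper \<inter> boxed N. region y)"
    if N: "m \<le> N" and B: "depends N B" "tail_set m B" "B \<subseteq> (\<Union>x\<in>F. region x)" for N B
  proof (rule ccontr)
    assume "\<not> ?thesis"
    then obtain z where z: "z \<in> B" "\<And>x. x \<in> upper \<Longrightarrow> h x \<in> boxed N \<Longrightarrow> z \<notin> region (h x)" by blast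
    define mid where "mid = {x \<in> upper. nx x \<le> N}"
    obtain N' where N': "N \<le> N'" "\<And>x. x \<in> F \<Longrightarrow> cuts x \<subseteq> {..<N'}"
      using index_bound[OF F(1,2)] by blast
    define far where "far = {x \<in> F. card (cuts x) \<le> 3 * card (cuts x \<inter> {N..<N'})}"
    have far: "finite far" "far \<subseteq> wclass p k" using F(1,2) by (auto simp: far_def)
    have "sum wt far \<le> sum wt F" using F(1) by (intro sum_mono2) (auto simp: far_def)
    with F(3) have "sum wt far < 4" by linarith
    from avoid_window[OF far this N'(1)] obtain z2
      where z2: "\<And>x w. x \<in> far \<Longrightarrow> agree N' (graft N (graft m a z) z2) w \<Longrightarrow> w \<notin> region x"
      unfolding far_def by blast
    \<comment> \<open>\<open>w\<close> follows \<open>a\<close> below \<open>m\<close>,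
      \<open>z\<close> from \<open>m\<close> to \<open>N\<close>, and \<open>z2\<close> afterwards;
      it avoids \<open>lower\<close> and \<open>far\<close> but still lies in
      \<open>B\<close>.\<close>
    define w where "w = graft N (graft m a z) z2"
    have w_eq: "w = graft m a (graft N z z2)"
      using N by (simp add: w_def graft_graft_le)
    have "graft m a z \<in> B" using B(2) z(1) by (simp add: tail_set_def)
    then have "w \<in> B" unfolding w_def using B(1) depD agree_graft(2) by blast
    then obtain x where x: "x \<in> F" "w \<in> region x" using B(3) by blast
    have "agree m a w" by (simp add: w_eq)
    with a x(2) have "x \<notin> lower" by blast
    have "x \<notin> far" using z2[of x w] x(2) unfolding w_def by fastforce
    have x_wclass: "x \<in> wclass p k" "finite (cuts x)" using x(1) F(2) wclass_finite by blast+
    have "x \<notin> mid"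
    proof
      assume "x \<in> mid"
      then have x_mid: "x \<in> upper" "nx x \<le> N" by (auto simp: mid_def)
      let ?J = "cuts x \<inter> {m..<nx x}"
      have J: "?J \<noteq> {}" using localize_third(1)[OF x_wclass(1) nx[OF x_mid(1)]] .
      have "Max ?J < nx x" using Max_in[OF _ J] x_wclass(2) by auto
      with x_mid(2) have MaxN: "Max ?J \<le> N" by simp
      \<comment> \<open>Weight below 16 forces more cuts than the level; all cuts of
        \<open>h x\<close> lie below \<open>N\<close>, so its level does too. This bounds the level
        needed for \<open>boxed N\<close>.\<close>
      have "wt x \<le> sum wt F" using F(1) x(1) by (intro member_le_sum) auto
      with h_wt[OF x_mid(1)] F(3) have "wt (h x) < 16" by linarith
      with wt_wclass_min_card[OF h_wclass[OF x_mid(1)]] have "min_card (level (h x)) < card (cuts (h x))" by blast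
      moreover have "card (cuts (h x)) \<le> card {..<N}"
        using x_mid(2) by (intro card_mono) (auto simp: h_def localize_def)
      ultimately have "level (h x) \<le> N" using min_card_gt[of "level (h x)"] by simp
      moreover have "depends N (region (h x))"
        using depends_mono[OF depends_cyl_hull MaxN] by (simp add: h_def localize_def)
      moreover have "cuts (h x) \<subseteq> {..<N}" using x_mid(2) by (auto simp: h_def localize_def)
      ultimately have "h x \<in> boxed N" by (simp add: boxed_def)
      with z(2) x_mid(1) have "z \<notin> region (h x)" by blast
      moreover have "agree (Max ?J) z (graft N z z2)" using agree_mono[OF agree_graft(2) MaxN] .
      moreover have "graft m a (graft N z z2) \<in> region x" using x(2) by (simp add: w_eq)
      ultimately show False by (auto simp: h_def localize_def cyl_hull_def)
    qed
    have "card (cuts x) \<le> 3 * card (cuts x \<inter> {m..<N}) \<Longrightarrow> False"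
    proof -
      assume *: "card (cuts x) \<le> 3 * card (cuts x \<inter> {m..<N})"
      then have "nx x \<le> N" unfolding nx_def by (rule Least_le)
      moreover have "x \<in> upper" using * x(1) by (auto simp: upper_def)
      ultimately show False using \<open>x \<notin> mid\<close> by (simp add: mid_def)
    qed
    moreover have "3 * card (cuts x \<inter> {0..<m}) < card (cuts x)" "3 * card (cuts x \<inter> {N..<N'}) < card (cuts x)"
      using x(1) \<open>x \<notin> lower\<close> \<open>x \<notin> far\<close> by (auto simp: lower_def far_def)
    moreover have "card (cuts x) = card (cuts x \<inter> {0..<m}) + card (cuts x \<inter> {m..<N}) + card (cuts x \<inter> {N..<N'})"
    proof -
      have "cuts x \<inter> {0..<N'} = cuts x" using N'(2)[OF x(1)] by auto
      then show ?thesis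
        using card_Int_atLeastLessThan_add[OF x_wclass(2), of 0 m N'] N N'(1)
          card_Int_atLeastLessThan_add[OF x_wclass(2), of m N N'] by simp
    qed
    ultimately show False by linarith
  qed
  show thesis
  proof (rule that)
    show "finite (h ` upper)" "h ` upper \<subseteq> wclass p k" "sum wt (h ` upper) \<le> 2"
      using fin(2) h_wclass sum_h by auto
    show "tail_set m (region y)" if "y \<in> h ` upper" for y
      using that by (auto simp: h_def localize_def intro!: tail_set_cyl_hull)
  qed (use cover in blast)
qed

text \<open>As \<open>B\<close> increases, a cover of the largest small \<open>B i\<close> with
  \<open>i \<le> p\<close> covers all smaller ones. The cover from \<open>window_cover\<close> does
  not depend on \<open>N\<close>, so one family serves every \<open>i\<close>.\<close>

lemma cover_sequence:
  assumes "mono B" "\<And>i. tail_set m (B i)" "\<And>i. m \<le> N i" "\<And>i. depends (N i) (B i)"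
  obtains F where "finite F" "F \<subseteq> wclass p k" "sum wt F \<le> 2" "\<And>y. y \<in> F \<Longrightarrow> tail_set m (region y)"
    "\<And>i. i \<le> p \<Longrightarrow> \<not> big (wclass p k) 1 (B i) \<Longrightarrow> B i \<subseteq> (\<Union>y\<in>F \<inter> boxed (N i). region y)"
proof (cases "\<exists>i\<le>p. \<not> big (wclass p k) 1 (B i)")
  case False
  then show thesis by (intro that[of "{}"]) auto
next
  case True
  define S where "S = {i. i \<le> p \<and> \<not> big (wclass p k) 1 (B i)}"
  have S: "finite S" "S \<noteq> {}" using True by (auto simp: S_def)
  then have "Max S \<in> S" by (rule Max_in)
  then obtain F where F: "finite F" "F \<subseteq> wclass p k" "B (Max S) \<subseteq> (\<Union>x\<in>F. region x)" "sum wt F < 1"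
    unfolding S_def big_def by (auto simp: not_le)
  obtain F' where F': "finite F'" "F' \<subseteq> wclass p k" "sum wt F' \<le> 2" "\<And>y. y \<in> F' \<Longrightarrow> tail_set m (region y)"
    "\<And>N B. m \<le> N \<Longrightarrow> depends N B \<Longrightarrow> tail_set m B \<Longrightarrow> B \<subseteq> (\<Union>x\<in>F. region x) \<Longrightarrow> B \<subseteq> (\<Union>y\<in>F' \<inter> boxed N. region y)"
    using window_cover[OF F(1,2,4), of m] by metis
  have "B i \<subseteq> (\<Union>y\<in>F' \<inter> boxed (N i). region y)" if "i \<le> p" "\<not> big (wclass p k) 1 (B i)" for i
  proof -
    have "i \<le> Max S" using that S(1) by (intro Max_ge) (auto simp: S_def)
    with assms(1) F(3) have "B i \<subseteq> (\<Union>x\<in>F. region x)" by (meson monoD subset_trans)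
    with F'(5) assms(2-4) show ?thesis by blast
  qed
  with F'(1-4) that show thesis by blast
qed

section \<open>Passage to the limit\<close>

text \<open>Zorn's lemma for families whose finite subfamilies have infinite intersections. If a
  maximal family missed both \<open>S\<close> and its complement, some finite intersection would be
  a union of two finite sets.\<close>

lemma ex_ultrafilter:
  "\<exists>U::nat filter. U \<noteq> bot \<and> U \<le> sequentially \<and> (\<forall>P. eventually P U \<or> eventually (\<lambda>x. \<not> P x) U)"
proof -
  define A :: "nat set set set" where "A = {M. \<forall>T\<subseteq>M. finite T \<longrightarrow> infinite (\<Inter>T)}"
  have "\<exists>M\<in>A. \<forall>Y\<in>A. M \<subseteq> Y \<longrightarrow> Y = M"
  proof (rule subset_Zorn_nonempty)
    show "A \<noteq> {}" by (auto simp: A_def intro!: exI[of _ "{}"])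
    show "\<Union>C \<in> A" if C: "C \<noteq> {}" "subset.chain A C" for C
      unfolding A_def
    proof (clarify)
      fix T assume T: "T \<subseteq> \<Union>C" "finite T" "finite (\<Inter>T)"
      obtain M where "M \<in> C" "T \<subseteq> M"
        using finite_subset_Union_chain[OF T(2,1) C] by blast
      with C(2) T(2,3) show False by (auto simp: A_def subset.chain_def)
    qed
  qed
  then obtain M where M: "M \<in> A" "\<And>Y. Y \<in> A \<Longrightarrow> M \<subseteq> Y \<Longrightarrow> Y = M" by blast
  have split: "\<exists>T\<subseteq>M. finite T \<and> finite (S \<inter> \<Inter>T)" if "S \<notin> M" for S
  proof -
    have "insert S M \<notin> A" using M(2)[of "insert S M"] that by blast
    then obtain T where T: "T \<subseteq> insert S M" "finite T" "finite (\<Inter>T)" by (auto simp: A_def)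
    have "finite (S \<inter> \<Inter>(T - {S}))" by (rule finite_subset[OF _ T(3)]) auto
    with T(1,2) show ?thesis by (intro exI[of _ "T - {S}"]) auto
  qed
  have ultra: "S \<in> M \<or> - S \<in> M" for S
  proof (rule ccontr)
    assume "\<not> ?thesis"
    then obtain T1 T2 where T: "T1 \<subseteq> M" "finite T1" "finite (S \<inter> \<Inter>T1)"
      "T2 \<subseteq> M" "finite T2" "finite (- S \<inter> \<Inter>T2)"
      using split by meson
    have "finite (\<Inter>(T1 \<union> T2))"
      by (rule finite_subset[of _ "(S \<inter> \<Inter>T1) \<union> (- S \<inter> \<Inter>T2)"]) (use T in auto)
    with M(1) T show False by (auto simp: A_def)
  qed
  define U where "U = (INF S\<in>M. principal S)"
  have U: "eventually (\<lambda>x. x \<in> S) U" if "S \<in> M" for S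
    unfolding U_def using that by (rule eventually_INF1) (simp add: eventually_principal)
  have "U \<noteq> bot"
    unfolding U_def
  proof (rule INF_filter_not_bot)
    fix T assume T: "T \<subseteq> M" "finite T"
    then have "infinite (\<Inter>T)" using M(1) unfolding A_def by blast
    then have "\<Inter>T \<noteq> {}" by (metis finite.emptyI)
    with T(2) show "(INF S\<in>T. principal S) \<noteq> bot"
      by (simp add: INF_principal_finite principal_eq_bot_iff)
  qed
  moreover have "U \<le> sequentially"
    unfolding le_sequentially
  proof
    fix N
    have "- {N..} \<notin> M"
    proof
      assume "- {N..} \<in> M"
      with M(1) have "infinite (\<Inter>{- {N..}})" unfolding A_def by blast
      then show False by (simp add: Compl_atLeast)
    qed
    with ultra have "{N..} \<in> M" by blast
    from U[OF this] show "eventually (\<lambda>n. N \<le> n) U" by simp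
  qed
  moreover have "eventually P U \<or> eventually (\<lambda>x. \<not> P x) U" for P
    using ultra[of "{x. P x}"] U[of "{x. P x}"] U[of "- {x. P x}"] by auto
  ultimately show ?thesis by blast
qed

definition ufilter :: "nat filter" where
  "ufilter = (SOME U. U \<noteq> bot \<and> U \<le> sequentially \<and> (\<forall>P. eventually P U \<or> eventually (\<lambda>x. \<not> P x) U))"

lemma ufilter: "ufilter \<noteq> bot" "ufilter \<le> sequentially" "eventually P ufilter \<or> eventually (\<lambda>x. \<not> P x) ufilter"
  using someI_ex[OF ex_ultrafilter] unfolding ufilter_def[symmetric] by auto

lemma ufilter_ge: "eventually (\<lambda>p. N \<le> p) ufilter"
  using ufilter(2) unfolding le_sequentially by blast

lemma ufilter_decide: "eventually (\<lambda>p. P p \<longleftrightarrow> eventually P ufilter) ufilter"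
  using ufilter(3)[of P] by (cases "eventually P ufilter") (auto elim: eventually_mono)

section \<open>Limit classes and covers by them\<close>

definition lim_class :: "nat \<Rightarrow> wset set" where
  "lim_class k = {x. eventually (\<lambda>p. x \<in> wclass p k) ufilter}"

definition covered :: "nat \<Rightarrow> real \<Rightarrow> (nat \<Rightarrow> nat) set \<Rightarrow> bool" where
  "covered k e Y \<longleftrightarrow> (\<exists>F. finite F \<and> F \<subseteq> lim_class k \<and> Y \<subseteq> (\<Union>x\<in>F. region x) \<and> sum wt F \<le> e)"

lemma lim_class_mono: "k \<le> k' \<Longrightarrow> lim_class k' \<subseteq> lim_class k"
  unfolding lim_class_def using wclass_mono by (auto elim!: eventually_mono)

lemma lim_class_finite:
  assumes "finite F" "F \<subseteq> lim_class k"
  shows "eventually (\<lambda>p. F \<subseteq> wclass p k) ufilter"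
proof -
  have "eventually (\<lambda>p. \<forall>x\<in>F. x \<in> wclass p k) ufilter"
    using assms by (intro eventually_ball_finite) (auto simp: lim_class_def)
  then show ?thesis by (simp add: subset_eq)
qed

lemma lim_class_obtain:
  assumes "finite F" "F \<subseteq> lim_class k"
  obtains p where "F \<subseteq> wclass p k"
  using eventually_happens[OF lim_class_finite[OF assms]] ufilter(1) by blast

lemma covered_mono: "covered k' e' Y' \<Longrightarrow> k \<le> k' \<Longrightarrow> Y \<subseteq> Y' \<Longrightarrow> e' \<le> e \<Longrightarrow> covered k e Y"
  unfolding covered_def using lim_class_mono by (meson order_trans)

lemma covered_empty: "0 \<le> e \<Longrightarrow> covered k e {}"
  unfolding covered_def by (intro exI[of _ "{}"]) simp

lemma covered_Un:
  assumes "covered k e Y" "covered k e' Y'"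
  shows "covered k (e + e') (Y \<union> Y')"
proof -
  obtain F F' where F: "finite F" "F \<subseteq> lim_class k" "Y \<subseteq> (\<Union>x\<in>F. region x)" "sum wt F \<le> e"
    and F': "finite F'" "F' \<subseteq> lim_class k" "Y' \<subseteq> (\<Union>x\<in>F'. region x)" "sum wt F' \<le> e'"
    using assms unfolding covered_def by blast
  have "sum wt (F \<union> F') \<le> sum wt F + sum wt F'"
    using F(1) F'(1) by (simp add: sum_Un sum_nonneg)
  with F F' show ?thesis
    unfolding covered_def by (intro exI[of _ "F \<union> F'"]) auto
qed

lemma covered_UN:
  assumes "finite S" "\<And>i. i \<in> S \<Longrightarrow> covered k e (Y i)"
  shows "covered k (real (card S) * e) (\<Union>i\<in>S. Y i)"
  using assms
proof (induction S rule: finite_induct)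
  case (insert i S)
  then have "covered k (e + card S * e) (Y i \<union> (\<Union>i\<in>S. Y i))" by (intro covered_Un) auto
  with insert.hyps show ?case by (simp add: algebra_simps)
qed (simp add: covered_empty)

text \<open>A finite part of the limit class lies in a single \<open>wclass p k\<close>, so the main
  estimate carries over.\<close>

lemma covered_UNIV: "covered k e UNIV \<Longrightarrow> 8 \<le> e"
proof -
  assume "covered k e UNIV"
  then obtain F where F: "finite F" "F \<subseteq> lim_class k" "UNIV \<subseteq> (\<Union>x\<in>F. region x)" "sum wt F \<le> e"
    unfolding covered_def by blast
  obtain p where "F \<subseteq> wclass p k" using lim_class_obtain[OF F(1,2)] .
  from bigD[OF big_UNIV F(1) this F(3)] F(4) level_bound_bounds(1)[of k] show ?thesis by linarith
qed

text \<open>\<open>F\<close> is the ultrafilter limit of the families from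
  \<open>cover_sequence\<close>. On the finite set \<open>boxed (N i)\<close> it agrees with almost
  all of them, so its part there covers \<open>B i\<close>. \<open>F\<close> may be infinite, but
  each finite part inherits the weight bound 2.\<close>

lemma limit_cover:
  fixes B :: "nat \<Rightarrow> (nat \<Rightarrow> nat) set"
  assumes B: "mono B" "\<And>i. tail_set m (B i)" "\<And>i. m \<le> N i" "\<And>i. depends (N i) (B i)"
    and small: "\<And>i. eventually (\<lambda>p. \<not> big (wclass p k) 1 (B i)) ufilter"
  obtains F where "F \<subseteq> lim_class k" "\<And>y. y \<in> F \<Longrightarrow> tail_set m (region y)"
    "\<And>G. finite G \<Longrightarrow> G \<subseteq> F \<Longrightarrow> sum wt G \<le> 2"
    "\<And>i. \<exists>G\<subseteq>F. finite G \<and> B i \<subseteq> (\<Union>y\<in>G. region y)"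
proof -
  have "\<forall>p. \<exists>F. finite F \<and> F \<subseteq> wclass p k \<and> sum wt F \<le> 2 \<and> (\<forall>y\<in>F. tail_set m (region y)) \<and>
      (\<forall>i\<le>p. \<not> big (wclass p k) 1 (B i) \<longrightarrow> B i \<subseteq> (\<Union>y\<in>F \<inter> boxed (N i). region y))"
  proof
    fix p
    show "\<exists>F. finite F \<and> F \<subseteq> wclass p k \<and> sum wt F \<le> 2 \<and> (\<forall>y\<in>F. tail_set m (region y)) \<and>
      (\<forall>i\<le>p. \<not> big (wclass p k) 1 (B i) \<longrightarrow> B i \<subseteq> (\<Union>y\<in>F \<inter> boxed (N i). region y))"
      by (rule cover_sequence[OF B, of p k]) blast
  qed
  then obtain Fs where Fs: "\<And>p. finite (Fs p)" "\<And>p. Fs p \<subseteq> wclass p k" "\<And>p. sum wt (Fs p) \<le> 2"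
    "\<And>p y. y \<in> Fs p \<Longrightarrow> tail_set m (region y)"
    "\<And>p i. i \<le> p \<Longrightarrow> \<not> big (wclass p k) 1 (B i) \<Longrightarrow> B i \<subseteq> (\<Union>y\<in>Fs p \<inter> boxed (N i). region y)"
    by metis
  define F where "F = {y. eventually (\<lambda>p. y \<in> Fs p) ufilter}"
  show thesis
  proof (rule that)
    show "F \<subseteq> lim_class k"
      using Fs(2) by (auto simp: F_def lim_class_def elim!: eventually_mono)
    show "tail_set m (region y)" if "y \<in> F" for y
    proof -
      have "eventually (\<lambda>p. y \<in> Fs p) ufilter" using that by (simp add: F_def)
      then obtain p where "y \<in> Fs p" using eventually_happens ufilter(1) by blast
      then show ?thesis by (rule Fs(4))
    qed
    show "sum wt G \<le> 2" if G: "finite G" "G \<subseteq> F" for G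
    proof -
      have "eventually (\<lambda>p. \<forall>y\<in>G. y \<in> Fs p) ufilter"
        using G by (intro eventually_ball_finite) (auto simp: F_def)
      then obtain p where "G \<subseteq> Fs p" using eventually_happens ufilter(1) by blast
      then have "sum wt G \<le> sum wt (Fs p)" using Fs(1) by (intro sum_mono2) auto
      with Fs(3)[of p] show ?thesis by linarith
    qed
    show "\<exists>G\<subseteq>F. finite G \<and> B i \<subseteq> (\<Union>y\<in>G. region y)" for i
    proof -
      have "eventually (\<lambda>p. \<forall>y\<in>boxed (N i). y \<in> Fs p \<longleftrightarrow> y \<in> F) ufilter"
        unfolding F_def mem_Collect_eq
        by (intro eventually_ball_finite finite_boxed ballI ufilter_decide)
      with small[of i] ufilter_ge[of i] have "eventually (\<lambda>p. i \<le> p \<and> \<not> big (wclass p k) 1 (B i) \<and>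
          (\<forall>y\<in>boxed (N i). y \<in> Fs p \<longleftrightarrow> y \<in> F)) ufilter"
        by (auto simp: eventually_conj_iff)
      then obtain p where p: "i \<le> p" "\<not> big (wclass p k) 1 (B i)" "\<forall>y\<in>boxed (N i). y \<in> Fs p \<longleftrightarrow> y \<in> F"
        using eventually_happens ufilter(1) by blast
      have "B i \<subseteq> (\<Union>y\<in>Fs p \<inter> boxed (N i). region y)" using Fs(5)[OF p(1,2)] .
      also have "Fs p \<inter> boxed (N i) = F \<inter> boxed (N i)" using p(3) by blast
      finally show ?thesis
        by (intro exI[of _ "F \<inter> boxed (N i)"]) (simp add: finite_boxed)
    qed
  qed
qed

text \<open>A finite part that nearly attains the supremum of the weights leaves at most
  \<open>e\<close> for any finite part of the rest.\<close>

lemma small_tail: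
  assumes bound: "\<And>G. finite G \<Longrightarrow> G \<subseteq> F \<Longrightarrow> sum wt G \<le> c" and "0 < e"
  shows "\<exists>F'\<subseteq>F. finite F' \<and> (\<forall>G. finite G \<longrightarrow> G \<subseteq> F - F' \<longrightarrow> sum wt G \<le> e)"
proof -
  let ?S = "{sum wt G |G. finite G \<and> G \<subseteq> F}"
  have S: "?S \<noteq> {}" "bdd_above ?S" using bound by (auto intro!: bdd_aboveI)
  have "Sup ?S - e < Sup ?S" using \<open>0 < e\<close> by simp
  then obtain F' where F': "finite F'" "F' \<subseteq> F" "Sup ?S - e < sum wt F'"
    using less_cSup_iff[OF S] by auto
  have "sum wt G \<le> e" if G: "finite G" "G \<subseteq> F - F'" for G
  proof -
    have "sum wt (F' \<union> G) \<le> Sup ?S"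
      using G F' by (intro cSup_upper[OF _ S(2)]) blast
    moreover have "sum wt (F' \<union> G) = sum wt F' + sum wt G"
      using G F' by (intro sum.union_disjoint) auto
    ultimately show ?thesis using F'(3) by linarith
  qed
  with F'(1,2) show ?thesis by blast
qed

lemma common_depends:
  assumes "\<And>i::nat. \<exists>n. depends n (E i)"
  obtains N where "mono N" "\<And>i. m \<le> N i" "\<And>i j. j \<le> i \<Longrightarrow> depends (N i) (E j)"
proof -
  obtain f where f: "\<And>i. depends (f i) (E i)" using assms by metis
  define N where "N i = Max (insert m (f ` {..i}))" for i
  have "mono N" unfolding N_def by (intro monoI Max_mono) auto
  moreover have "m \<le> N i" for i unfolding N_def by (intro Max_ge) auto
  moreover have "depends (N i) (E j)" if "j \<le> i" for i j
  proof -
    have "f j \<le> N i" unfolding N_def using that by (intro Max_ge) auto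
    with f show ?thesis by (rule depends_mono)
  qed
  ultimately show thesis using that by blast
qed

text \<open>
  Either finitely many of the \<open>E i\<close> already have a large union inside the cylinder of \<open>a\<close>, which then
  serves as \<open>C\<close>; or all these unions are small, and \<open>C\<close> is the complement of a finite part of a cover
  of all of them.
\<close>

lemma local_thin_set:
  assumes E: "disjoint_family E" "\<And>i::nat. \<exists>n. depends n (E i)" and "0 < e"
  obtains n C i0 where "depends n C" "tail_set m C" "eventually (\<lambda>p. big (wclass p k) 1 C) ufilter"
    "\<And>i. i0 \<le> i \<Longrightarrow> covered k e (E i \<inter> {w. agree m a w} \<inter> C)"
proof -
  define B where "B i = (\<Union>j\<in>{..i}. {z. graft m a z \<in> E j})" for i :: nat
  obtain N where N: "mono N" "\<And>i. m \<le> N i" "\<And>i j. j \<le> i \<Longrightarrow> depends (N i) (E j)"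
    by (rule common_depends[of E m, OF E(2)]) (rule that)
  have B: "mono B" "\<And>i. tail_set m (B i)" "\<And>i. depends (N i) (B i)"
  proof -
    show "mono B" unfolding B_def by (intro monoI UN_mono) auto
    show "tail_set m (B i)" for i unfolding B_def by (intro tail_set_UN tail_set_vimage)
    show "depends (N i) (B i)" for i
      unfolding B_def by (intro depends_UN depends_vimage N(3)) simp
  qed
  have to_B: "w \<in> B i" if "w \<in> E j" "j \<le> i" "agree m a w" for w i j
  proof -
    have "agree (N i) w (graft m a w)" using agree_sym[OF agree_graft_same[OF that(3)]] .
    then have "graft m a w \<in> E j" using N(3)[OF that(2)] that(1) depD by blast
    with that(2) show ?thesis by (auto simp: B_def)
  qed
  have of_B: "\<exists>j\<le>i. w \<in> E j" if w: "w \<in> B i" "agree m a w" for w i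
  proof -
    obtain j where j: "j \<le> i" "graft m a w \<in> E j" using w(1) by (auto simp: B_def)
    have "agree (N i) (graft m a w) w" using agree_graft_same[OF w(2)] .
    then have "w \<in> E j" using N(3)[OF j(1)] j(2) depD by blast
    with j(1) show ?thesis by blast
  qed
  show thesis
  proof (cases "\<exists>i. eventually (\<lambda>p. big (wclass p k) 1 (B i)) ufilter")
    case True
    then obtain i0 where i0: "eventually (\<lambda>p. big (wclass p k) 1 (B i0)) ufilter" by blast
    have "E i \<inter> {w. agree m a w} \<inter> B i0 = {}" if "Suc i0 \<le> i" for i
    proof (rule ccontr)
      assume "E i \<inter> {w. agree m a w} \<inter> B i0 \<noteq> {}"
      then obtain w where w: "w \<in> E i" "agree m a w" "w \<in> B i0" by blast
      obtain j where "j \<le> i0" "w \<in> E j" using of_B[OF w(3,2)] by blast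
      moreover have "E i \<inter> E j = {}"
        using E(1) that \<open>j \<le> i0\<close> by (auto simp: disjoint_family_on_def)
      ultimately show False using w(1) by blast
    qed
    then have "covered k e (E i \<inter> {w. agree m a w} \<inter> B i0)" if "Suc i0 \<le> i" for i
      using that \<open>0 < e\<close> by (simp add: covered_empty)
    with i0 B that show thesis by blast
  next
    case False
    then have "eventually (\<lambda>p. \<not> big (wclass p k) 1 (B i)) ufilter" for i
      using ufilter(3) by blast
    then obtain F where F: "F \<subseteq> lim_class k"
      "\<And>y. y \<in> F \<Longrightarrow> tail_set m (region y)" "\<And>G. finite G \<Longrightarrow> G \<subseteq> F \<Longrightarrow> sum wt G \<le> 2"
      "\<And>i. \<exists>G\<subseteq>F. finite G \<and> B i \<subseteq> (\<Union>y\<in>G. region y)"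
      by (rule limit_cover[OF B(1,2) N(2) B(3)]) (rule that)
    have "\<exists>F'\<subseteq>F. finite F' \<and> (\<forall>G. finite G \<longrightarrow> G \<subseteq> F - F' \<longrightarrow> sum wt G \<le> e)"
      using F(3) \<open>0 < e\<close> by (rule small_tail)
    then obtain F' where F': "finite F'" "F' \<subseteq> F" "\<And>G. finite G \<Longrightarrow> G \<subseteq> F - F' \<Longrightarrow> sum wt G \<le> e"
      by blast
    define C where "C = - (\<Union>y\<in>F'. region y)"
    have F'_lim: "F' \<subseteq> lim_class k" using F(1) F'(2) by blast
    obtain p where p: "F' \<subseteq> wclass p k" using lim_class_obtain[OF F'(1) F'_lim] .
    obtain n where n: "\<And>x. x \<in> F' \<Longrightarrow> cuts x \<subseteq> {..<n}"
      by (rule index_bound[OF F'(1) p]) (rule that)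
    have "depends n (region y)" if "y \<in> F'" for y
    proof -
      have y: "y \<in> wclass p k" using p that by blast
      then have "Max (cuts y) \<in> cuts y"
        unfolding wclass_iff adm_def by (intro Max_in) blast+
      with n[OF that] have "Max (cuts y) \<le> n" by auto
      with wclass_depends[OF y] show ?thesis by (rule depends_mono)
    qed
    then have "depends n C" unfolding C_def by (intro depends_Compl depends_UN)
    moreover have "tail_set m C"
      unfolding C_def using F(2) F'(2) by (intro tail_set_Compl tail_set_UN) blast
    \<comment> \<open>The removed family weighs at most 2, while covering the whole space costs at
      least 8.\<close>
    moreover have "big (wclass p k) 1 C" if "F' \<subseteq> wclass p k" for p
      unfolding big_def
    proof (intro allI impI)
      fix G assume G: "finite G" "G \<subseteq> wclass p k" "C \<subseteq> (\<Union>x\<in>G. region x)"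
      have "UNIV \<subseteq> (\<Union>x\<in>F' \<union> G. region x)" using G(3) by (auto simp: C_def)
      then have "level_bound k \<le> sum wt (F' \<union> G)"
        using bigD[OF big_UNIV, of "F' \<union> G" p k] G F'(1) that by blast
      also have "\<dots> \<le> sum wt F' + sum wt G"
        using G(1) F'(1) by (simp add: sum_Un sum_nonneg)
      finally show "1 \<le> sum wt G" using F(3)[OF F'(1,2)] level_bound_bounds(1)[of k] by linarith
    qed
    then have "eventually (\<lambda>p. big (wclass p k) 1 C) ufilter"
      using lim_class_finite[OF F'(1) F'_lim] by (auto elim: eventually_mono)
    moreover have "covered k e (E i \<inter> {w. agree m a w} \<inter> C)" for i
    proof -
      obtain G where G: "G \<subseteq> F" "finite G" "B i \<subseteq> (\<Union>y\<in>G. region y)" using F(4) by blast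
      have "E i \<inter> {w. agree m a w} \<inter> C \<subseteq> (\<Union>y\<in>G - F'. region y)"
      proof
        fix w assume w: "w \<in> E i \<inter> {w. agree m a w} \<inter> C"
        then have "w \<in> B i" using to_B[of w i i] by simp
        with G(3) obtain y where "y \<in> G" "w \<in> region y" by blast
        with w show "w \<in> (\<Union>y\<in>G - F'. region y)" by (auto simp: C_def)
      qed
      moreover have "sum wt (G - F') \<le> e" using G F'(3)[of "G - F'"] by auto
      ultimately show ?thesis
        unfolding covered_def using G F(1) by (intro exI[of _ "G - F'"]) auto
    qed
    ultimately show thesis using that by blast
  qed
qed

section \<open>The exhaustive submeasure\<close>

text \<open>\<open>local_thin_set\<close> is applied in each of the finitely many cylinders of
  length \<open>m\<close>, with an equal share of \<open>e\<close>; \<open>G\<close> is what the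
  chosen sets \<open>C\<close> leave out.\<close>

lemma thin_set:
  assumes E: "disjoint_family E" "\<And>i::nat. \<exists>n. depends n (E i)" and "0 < e"
  shows "\<exists>n G. m < n \<and> depends n G \<and> eventually (\<lambda>p. thin (wclass p k) m n G) ufilter \<and>
    eventually (\<lambda>i. covered k e (E i - G)) sequentially"
proof -
  define R where "R = range (rep m)"
  have R: "finite R" "R \<noteq> {}" by (simp_all add: R_def finite_range_rep)
  then have cardR: "0 < card R" by (simp add: card_gt_0_iff)
  define d where "d = e / card R"
  have "0 < d" using \<open>0 < e\<close> cardR by (simp add: d_def)
  have "\<forall>a. \<exists>n C i0. depends n C \<and> tail_set m C \<and> eventually (\<lambda>p. big (wclass p k) 1 C) ufilter \<and>
      (\<forall>i\<ge>i0. covered k d (E i \<inter> {w. agree m a w} \<inter> C))"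
  proof
    fix a
    show "\<exists>n C i0. depends n C \<and> tail_set m C \<and> eventually (\<lambda>p. big (wclass p k) 1 C) ufilter \<and>
      (\<forall>i\<ge>i0. covered k d (E i \<inter> {w. agree m a w} \<inter> C))"
      by (rule local_thin_set[OF E \<open>0 < d\<close>, of m k a]) blast
  qed
  then obtain nf C i0 where C: "\<And>a. depends (nf a) (C a)" "\<And>a. tail_set m (C a)"
    "\<And>a. eventually (\<lambda>p. big (wclass p k) 1 (C a)) ufilter"
    "\<And>a i. i0 a \<le> i \<Longrightarrow> covered k d (E i \<inter> {w. agree m a w} \<inter> C a)"
    by metis
  define n where "n = Max (insert (Suc m) (nf ` R))"
  have n: "Suc m \<le> n" "\<And>a. a \<in> R \<Longrightarrow> nf a \<le> n"
    unfolding n_def using R(1) by (auto intro!: Max_ge)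
  define G where "G = {w. w \<notin> C (rep m w)}"
  have "depends n G"
    unfolding depends_def
  proof (intro allI impI)
    fix w w' assume w: "agree n w w'" "w \<in> G"
    then have "rep m w = rep m w'" using n(1) agree_mono agree_iff_rep Suc_leD by blast
    moreover have "depends n (C (rep m w))" using depends_mono[OF C(1) n(2)] by (simp add: R_def)
    ultimately show "w' \<in> G" using w depends_iff unfolding G_def mem_Collect_eq by metis
  qed
  moreover have "thin (wclass p k) m n G" if p: "\<forall>a\<in>R. big (wclass p k) 1 (C a)" for p
    unfolding thin_def
  proof
    fix a
    let ?C = "C (rep m a)"
    have rep: "rep m (graft m a z) = rep m a" for z by (simp flip: agree_iff_rep)
    have "rep m a \<in> R" by (simp add: R_def)
    moreover from this have "depends n ?C" using depends_mono[OF C(1) n(2)] by blast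
    moreover have "graft m a z \<notin> G" if "z \<in> ?C" for z
      using that C(2)[of "rep m a"] unfolding G_def by (simp add: rep tail_set_iff)
    ultimately show "\<exists>C. depends n C \<and> (\<forall>z\<in>C. graft m a z \<notin> G) \<and> big (wclass p k) 1 C"
      using p by blast
  qed
  moreover have "eventually (\<lambda>p. \<forall>a\<in>R. big (wclass p k) 1 (C a)) ufilter"
    using C(3) R(1) by (intro eventually_ball_finite) auto
  ultimately have "eventually (\<lambda>p. thin (wclass p k) m n G) ufilter"
    by (auto elim: eventually_mono)
  moreover have "eventually (\<lambda>i. covered k e (E i - G)) sequentially"
    unfolding eventually_sequentially
  proof (intro exI allI impI)
    fix i assume i: "Max (i0 ` R) \<le> i"
    have "covered k d (E i \<inter> {w. agree m a w} \<inter> C a)" if "a \<in> R" for a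
    proof (rule C(4))
      have "i0 a \<le> Max (i0 ` R)" using R(1) that by (intro Max_ge) auto
      with i show "i0 a \<le> i" by linarith
    qed
    then have "covered k (card R * d) (\<Union>a\<in>R. E i \<inter> {w. agree m a w} \<inter> C a)"
      by (rule covered_UN[OF R(1)])
    moreover have "E i - G \<subseteq> (\<Union>a\<in>R. E i \<inter> {w. agree m a w} \<inter> C a)"
    proof
      fix w assume "w \<in> E i - G"
      then have "w \<in> E i \<inter> {w'. agree m (rep m w) w'} \<inter> C (rep m w)" by (simp add: G_def)
      moreover have "rep m w \<in> R" by (simp add: R_def)
      ultimately show "w \<in> (\<Union>a\<in>R. E i \<inter> {w. agree m a w} \<inter> C a)" by blast
    qed
    moreover have "card R * d = e" using cardR by (simp add: d_def)
    ultimately show "covered k e (E i - G)" by (auto elim: covered_mono)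
  qed
  moreover have "m < n" using n(1) by simp
  ultimately show ?thesis using \<open>depends n G\<close> by blast
qed

lemma thin_mono: "thin D m n E \<Longrightarrow> n \<le> n' \<Longrightarrow> E' \<subseteq> E \<Longrightarrow> thin D m n' E'"
  unfolding thin_def using depends_mono by (meson subsetD)

theorem covered_exhaustive:
  assumes E: "disjoint_family E" "\<And>i::nat. \<exists>n. depends n (E i)" and "0 < e"
  shows "eventually (\<lambda>i. covered k ((1 / 2) ^ k + e) (E i)) sequentially"
proof -
  define d where "d = e / max_card k"
  have "0 < d" using \<open>0 < e\<close> by (simp add: d_def)
  then obtain nf G where G: "\<And>m. m < nf m" "\<And>m. depends (nf m) (G m)"
    "\<And>m. eventually (\<lambda>p. thin (wclass p (Suc k)) m (nf m) (G m)) ufilter"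
    "\<And>m. eventually (\<lambda>i. covered (Suc k) d (E i - G m)) sequentially"
    using thin_set[OF E, of d _ "Suc k"] by metis
  define u where "u j = (nf ^^ j) 0" for j
  have u_Suc: "u (Suc j) = nf (u j)" for j by (simp add: u_def)
  then have u: "strict_mono u" by (intro strict_monoI_Suc) (simp add: G(1))
  define M where "M = max_card k - 1"
  have M: "max_card k = Suc M" unfolding M_def by (metis Suc_pred' max_card_pos)
  define I where "I = u ` {..M}"
  define E0 where "E0 = (\<Inter>j\<in>{..<M}. G (u j))"
  define x :: wset where "x = (k, E0, I)"
  have I: "finite I" "card I = max_card k" "Max I = u M"
  proof -
    show "finite I" by (simp add: I_def)
    show "card I = max_card k"
      using card_image[OF strict_mono_imp_inj_on[OF u], of "{..M}"] by (simp add: I_def M)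
    show "Max I = u M"
      unfolding I_def using strict_mono_mono[OF u] by (intro Max_eqI) (auto dest: monoD)
  qed
  have depE0: "depends (u M) E0"
    unfolding E0_def
  proof (rule depends_INT)
    fix j assume "j \<in> {..<M}"
    then have "u (Suc j) \<le> u M" using strict_mono_less_eq[OF u] by auto
    then show "depends (u M) (G (u j))" using depends_mono[OF G(2)] by (simp add: u_Suc)
  qed
  have "x \<in> wclass p k"
    if p: "k < p" "\<forall>j\<in>{..<M}. thin (wclass p (Suc k)) (u j) (u (Suc j)) (G (u j))" for p
  proof -
    \<comment> \<open>\<open>G (u i)\<close> is already thin from \<open>u i\<close> to the next
      cut, and thinness persists for later cuts and for subsets.\<close>
    have "thin (wclass p (Suc k)) m n E0" if mn: "m \<in> I" "n \<in> I" "m < n" for m n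
    proof -
      obtain i j where ij: "m = u i" "n = u j" "i \<le> M" "j \<le> M"
        using mn(1,2) by (auto simp: I_def)
      with mn(3) have "i < j" using strict_mono_less[OF u] by auto
      then have "u (Suc i) \<le> u j" using strict_mono_less_eq[OF u] by auto
      moreover have "i \<in> {..<M}" using \<open>i < j\<close> ij(4) by simp
      moreover from this have "E0 \<subseteq> G (u i)" by (auto simp: E0_def)
      ultimately show ?thesis using p(2) thin_mono ij(1,2) by blast
    qed
    moreover have "I \<noteq> {}" by (simp add: I_def)
    ultimately show ?thesis
      using p(1) I depE0 unfolding wclass_iff adm_def by (simp add: x_def)
  qed
  moreover have "eventually (\<lambda>p. k < p \<and>
      (\<forall>j\<in>{..<M}. thin (wclass p (Suc k)) (u j) (u (Suc j)) (G (u j)))) ufilter"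
    using ufilter_ge[of "Suc k"] G(3) unfolding u_Suc
    by (intro eventually_conj eventually_ball_finite) (auto simp: Suc_le_eq)
  ultimately have "x \<in> lim_class k"
    unfolding lim_class_def by (auto elim: eventually_mono)
  then have cov0: "covered k ((1 / 2) ^ k) E0"
    unfolding covered_def by (intro exI[of _ "{x}"]) (simp add: x_def wt_def I)
  have "eventually (\<lambda>i. \<forall>j\<in>{..<M}. covered (Suc k) d (E i - G (u j))) sequentially"
    using G(4) by (intro eventually_ball_finite) auto
  then show ?thesis
  proof (rule eventually_mono)
    fix i assume i: "\<forall>j\<in>{..<M}. covered (Suc k) d (E i - G (u j))"
    then have "covered (Suc k) (card {..<M} * d) (\<Union>j\<in>{..<M}. E i - G (u j))"
      by (intro covered_UN) auto
    moreover have "card {..<M} * d \<le> e"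
    proof -
      have "M * d \<le> max_card k * d" using \<open>0 < d\<close> by (intro mult_right_mono) (auto simp: M)
      then show ?thesis by (simp add: d_def)
    qed
    ultimately have "covered k e (\<Union>j\<in>{..<M}. E i - G (u j))"
      by (auto intro: covered_mono)
    from covered_Un[OF cov0 this] show "covered k ((1 / 2) ^ k + e) (E i)"
      by (rule covered_mono) (auto simp: E0_def)
  qed
qed

text \<open>Setting coordinate \<open>i\<close> to \<open>t i\<close> leaves the set, and by
  \<open>big_coordinate\<close> this is a large event. So the set is thin, and with
  \<open>max_card k\<close> cuts its weight is \<open>(1 / 2) ^ k\<close>.\<close>

lemma covered_avoid_coordinates:
  assumes t: "\<And>i. t i \<le> i"
  shows "covered k ((1 / 2) ^ k) {z. \<forall>i\<in>{n..<n + max_card k}. z i mod Suc i \<noteq> t i}"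
proof -
  define E where "E = {z. \<forall>i\<in>{n..<n + max_card k}. z i mod Suc i \<noteq> t i}"
  \<comment> \<open>The shift by one makes coordinate \<open>i\<close> visible to a set that depends
    on the coordinates below the cut \<open>Suc i\<close>.\<close>
  define I where "I = Suc ` {n..<n + max_card k}"
  have I: "finite I" "card I = max_card k" by (auto simp: I_def card_image)
  have "depends (Max I) E"
    unfolding depends_def
  proof (intro allI impI)
    fix z z' assume z: "agree (Max I) z z'" "z \<in> E"
    have "i < Max I" if "i \<in> {n..<n + max_card k}" for i
    proof -
      have "Suc i \<in> I" using that by (simp add: I_def)
      from Max_ge[OF I(1) this] show ?thesis by simp
    qed
    with z show "z' \<in> E" by (auto simp: E_def agree_def)
  qed
  moreover have "thin (wclass p (Suc k)) m n' E" if mn: "m \<in> I" "n' \<in> I" "m < n'" for m n' p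
  proof -
    obtain i where i: "n' = Suc i" "i \<in> {n..<n + max_card k}" using mn(2) unfolding I_def by blast
    let ?C = "{z. z i mod Suc i = t i}"
    have "depends n' ?C" by (auto simp: depends_def agree_def i(1))
    moreover have "graft m a z \<notin> E" if "z \<in> ?C" for z a
      using that i \<open>m < n'\<close> by (auto simp: E_def graft_def intro!: bexI[of _ i])
    moreover have "big (wclass p (Suc k)) 1 ?C" by (rule big_coordinate[OF t])
    ultimately show ?thesis unfolding thin_def by blast
  qed
  moreover have "I \<noteq> {}" using I(2) by (metis card.empty max_card_pos less_irrefl)
  ultimately have "(k, E, I) \<in> wclass p k" if "k < p" for p
    using I that by (simp add: wclass_iff adm_def)
  then have "(k, E, I) \<in> lim_class k"
    unfolding lim_class_def using ufilter_ge[of "Suc k"] by (auto simp: Suc_le_eq elim!: eventually_mono)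
  then show ?thesis
    unfolding covered_def E_def[symmetric] by (intro exI[of _ "{(k, E, I)}"]) (simp add: wt_def I)
qed

text \<open>In a lighter cover every member has level above \<open>2 * n\<close>, hence more than
  \<open>2 * n\<close> cuts, of which at most \<open>n\<close> lie before \<open>n\<close>. So all
  members can be avoided after fixing the first \<open>n\<close> coordinates of
  \<open>z\<close>.\<close>

lemma covered_lower_bound:
  assumes Y: "depends n Y" "z \<in> Y" and "covered k e Y"
  shows "(1 / 2) ^ (2 * n) \<le> e"
proof (rule ccontr)
  assume "\<not> ?thesis"
  then have e: "e < (1 / 2) ^ (2 * n)" by simp
  have "(1 / 2 :: real) ^ (2 * n) \<le> 1" by (rule power_le_one) auto
  with e have "e < 1" by linarith
  obtain F where F: "finite F" "F \<subseteq> lim_class k" "Y \<subseteq> (\<Union>x\<in>F. region x)" "sum wt F \<le> e"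
    using assms(3) unfolding covered_def by blast
  obtain p where p: "F \<subseteq> wclass p k" using lim_class_obtain[OF F(1,2)] .
  obtain N where N: "n \<le> N" "\<And>x. x \<in> F \<Longrightarrow> cuts x \<subseteq> {..<N}"
    using index_bound[OF F(1) p] by blast
  have third: "card (cuts x) \<le> 3 * card (cuts x \<inter> {n..<N})" if x: "x \<in> F" for x
  proof -
    have x_wclass: "x \<in> wclass p k" using x p by blast
    have "wt x \<le> sum wt F" using F(1) x by (intro member_le_sum) auto
    with F(4) e have wt: "wt x < (1 / 2) ^ (2 * n)" by linarith
    have "(1 / 2) ^ level x \<le> wt x" using wt_wclass_ge[OF x_wclass] .
    with wt have "(1 / 2 :: real) ^ level x < (1 / 2) ^ (2 * n)" by linarith
    then have "2 * n < level x" by (subst (asm) power_strict_decreasing_iff) auto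
    moreover have "min_card (level x) < card (cuts x)"
      using wt_wclass_min_card[OF x_wclass] wt \<open>e < 1\<close> F(4) \<open>wt x \<le> sum wt F\<close> by linarith
    ultimately have "2 * n < card (cuts x)" using min_card_gt[of "level x"] by linarith
    moreover have "card (cuts x \<inter> {0..<n}) \<le> n"
      using card_mono[of "{0..<n}" "cuts x \<inter> {0..<n}"] by simp
    moreover have "cuts x \<inter> {0..<N} = cuts x" using N(2)[OF x] by auto
    then have "card (cuts x) = card (cuts x \<inter> {0..<n}) + card (cuts x \<inter> {n..<N})"
      using card_Int_atLeastLessThan_add[OF wclass_finite[OF x_wclass], of 0 n N] N(1) by simp
    ultimately show ?thesis by linarith
  qed
  have "sum wt F < 4" using F(4) \<open>e < 1\<close> by linarith
  obtain z' where z': "\<And>x w. x \<in> F \<Longrightarrow> agree N (graft n z z') w \<Longrightarrow> w \<notin> region x"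
    by (rule avoid_window[OF F(1) p \<open>sum wt F < 4\<close> N(1) third, of z]) blast+
  have "graft n z z' \<in> Y" using depD[OF Y(1) agree_graft(2) Y(2)] .
  then show False using F(3) z'[OF _ agree_refl] by blast
qed

section \<open>The limit submeasure\<close>

definition nu :: "(nat \<Rightarrow> nat) set \<Rightarrow> real" where
  "nu Y = Inf {e. covered 0 e Y}"

lemma covered_nonneg: "covered k e Y \<Longrightarrow> 0 \<le> e"
  unfolding covered_def by (meson order_trans sum_nonneg wt_nonneg)

lemma ex_covered: "\<exists>e. covered 0 e Y"
proof -
  define x :: wset where "x = (0, UNIV, {0})"
  have "x \<in> wclass p 0" if "0 < p" for p
    using that max_card_pos[of 0] by (simp add: wclass_iff adm_def x_def Suc_le_eq)
  then have "x \<in> lim_class 0"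
    unfolding lim_class_def using ufilter_ge[of "Suc 0"] by (auto simp: Suc_le_eq elim!: eventually_mono)
  then have "covered 0 (wt x) Y"
    unfolding covered_def by (intro exI[of _ "{x}"]) (simp add: x_def)
  then show ?thesis by blast
qed

lemma nu_le: "covered 0 e Y \<Longrightarrow> nu Y \<le> e"
  unfolding nu_def using covered_nonneg by (intro cInf_lower) (auto intro!: bdd_belowI)

lemma nu_less: "nu Y < e \<Longrightarrow> covered 0 e Y"
proof -
  assume "nu Y < e"
  then obtain e' where "covered 0 e' Y" "e' < e"
    unfolding nu_def using cInf_lessD[of "{e. covered 0 e Y}" e] ex_covered[of Y] by auto
  then show ?thesis by (auto elim: covered_mono)
qed

lemma le_nu: "(\<And>e. covered 0 e Y \<Longrightarrow> c \<le> e) \<Longrightarrow> c \<le> nu Y"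
  unfolding nu_def using ex_covered[of Y] by (intro cInf_greatest) auto

lemma nu_nonneg [simp]: "0 \<le> nu Y"
  using covered_nonneg by (rule le_nu)

lemma nu_empty [simp]: "nu {} = 0"
  using nu_le[OF covered_empty[of 0]] nu_nonneg[of "{}"] by linarith

lemma nu_mono: "Y \<subseteq> Y' \<Longrightarrow> nu Y \<le> nu Y'"
  by (rule le_nu) (auto intro: nu_le elim: covered_mono)

lemma nu_Un: "nu (Y \<union> Y') \<le> nu Y + nu Y'"
proof (rule field_le_epsilon)
  fix e :: real assume "0 < e"
  then have "covered 0 (nu Y + e / 2) Y" "covered 0 (nu Y' + e / 2) Y'"
    by (auto intro!: nu_less)
  from nu_le[OF covered_Un[OF this]] show "nu (Y \<union> Y') \<le> nu Y + nu Y' + e" by simp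
qed

lemma nu_lower_bound: "depends n Y \<Longrightarrow> z \<in> Y \<Longrightarrow> (1 / 2) ^ (2 * n) \<le> nu Y"
  by (rule le_nu) (rule covered_lower_bound)

lemma nu_UNIV: "8 \<le> nu UNIV"
  by (rule le_nu) (rule covered_UNIV)

theorem nu_exhaustive:
  assumes "disjoint_family E" "\<And>i::nat. \<exists>n. depends n (E i)" and "0 < e"
  shows "eventually (\<lambda>i. nu (E i) < e) sequentially"
proof -
  obtain k where k: "(1 / 2) ^ k < e / 2"
    using real_arch_pow_inv[of "e / 2" "1 / 2"] \<open>0 < e\<close> by auto
  have "0 < e / 3" using \<open>0 < e\<close> by simp
  from covered_exhaustive[OF assms(1,2) this, of k] show ?thesis
  proof (rule eventually_mono)
    fix i assume "covered k ((1 / 2) ^ k + e / 3) (E i)"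
    then have "covered 0 ((1 / 2) ^ k + e / 3) (E i)" by (rule covered_mono) auto
    from nu_le[OF this] k \<open>0 < e\<close> show "nu (E i) < e" by linarith
  qed
qed

section \<open>The clopen algebra and the absence of a control\<close>

definition clopen :: "(nat \<Rightarrow> nat) set set" where
  "clopen = {Y. \<exists>n. depends n Y}"

lemma algebra_clopen: "Sigma_Algebra.algebra UNIV clopen"
proof (rule algebra_iff_Un[THEN iffD2], intro conjI ballI)
  show "{} \<in> clopen" by (auto simp: clopen_def)
  show "UNIV - Y \<in> clopen" if "Y \<in> clopen" for Y
    using that depends_Compl by (auto simp: clopen_def Compl_eq_Diff_UNIV[symmetric])
  show "Y \<union> Y' \<in> clopen" if Y: "Y \<in> clopen" "Y' \<in> clopen" for Y Y'
  proof -
    obtain m n where "depends m Y" "depends n Y'" using Y by (auto simp: clopen_def)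
    then have "depends (max m n) (Y \<union> Y')" by (intro depends_Un) (auto elim: depends_mono)
    then show ?thesis by (auto simp: clopen_def)
  qed
qed simp

text \<open>Coordinate \<open>i\<close> takes \<open>i + 1\<close> values, so one of them has
  measure at most \<open>\<mu> UNIV / (i + 1)\<close>. A union of \<open>max_card 1\<close> such
  sets over late coordinates has small measure, yet its complement has \<open>nu\<close> at most 1/2
  while the whole space has at least 8.\<close>

theorem nu_no_control:
  assumes mu: "positive_measure clopen \<mu>" and "0 < \<alpha>"
  shows "\<exists>Y\<in>clopen. \<mu> Y \<le> \<alpha> \<and> 1 < nu Y"
proof -
  interpret Sigma_Algebra.algebra UNIV clopen by (rule algebra_clopen)
  have mu: "0 \<le> \<mu> Y" "\<mu> {} = 0" "Measure_Space.additive clopen \<mu>" if "Y \<in> clopen" for Y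
    using mu that by (auto simp: positive_measure_def)
  note add = additiveD[OF mu(3)[OF empty_sets]]
  have mono: "\<mu> Y \<le> \<mu> Y'" if "Y \<in> clopen" "Y' \<in> clopen" "Y \<subseteq> Y'" for Y Y'
  proof -
    have "\<mu> (Y \<union> (Y' - Y)) = \<mu> Y + \<mu> (Y' - Y)" using that by (intro add) auto
    moreover have "Y \<union> (Y' - Y) = Y'" using that(3) by auto
    ultimately show ?thesis using mu(1)[of "Y' - Y"] that by auto
  qed
  have subadd: "\<mu> (\<Union>i\<in>S. A i) \<le> (\<Sum>i\<in>S. \<mu> (A i))"
    if "finite S" "\<And>i. i \<in> S \<Longrightarrow> A i \<in> clopen" for S :: "nat set" and A
    using that
  proof (induction S rule: finite_induct)
    case empty
    then show ?case using mu(2)[OF empty_sets] by simp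
  next
    case (insert i S)
    let ?U = "\<Union>i\<in>S. A i"
    have U: "?U \<in> clopen" "A i \<in> clopen" using insert by auto
    have "\<mu> (A i \<union> (?U - A i)) = \<mu> (A i) + \<mu> (?U - A i)" using U by (intro add) auto
    moreover have "\<mu> (?U - A i) \<le> \<mu> ?U" using U by (intro mono) auto
    moreover have "\<mu> ?U \<le> (\<Sum>i\<in>S. \<mu> (A i))" using insert by auto
    ultimately show ?case using insert.hyps by simp
  qed
  define S where "S i t = {z :: nat \<Rightarrow> nat. z i mod Suc i = t}" for i t
  have S: "S i t \<in> clopen" for i t
    unfolding clopen_def by (auto simp: S_def depends_def agree_def intro!: exI[of _ "Suc i"])
  have sum_S: "(\<Sum>t\<in>T. \<mu> (S i t)) = \<mu> (\<Union>t\<in>T. S i t)" if "finite T" for i T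
    using that
  proof (induction T rule: finite_induct)
    case empty
    then show ?case using mu(2)[OF empty_sets] by simp
  next
    case (insert t T)
    have "\<mu> (S i t \<union> (\<Union>t\<in>T. S i t)) = \<mu> (S i t) + \<mu> (\<Union>t\<in>T. S i t)"
      using insert S by (intro add finite_UN) (auto simp: S_def)
    with insert show ?case by simp
  qed
  have "\<exists>t\<le>i. \<mu> (S i t) \<le> \<mu> UNIV / Suc i" for i
  proof (rule ccontr)
    assume "\<not> ?thesis"
    then have "(\<Sum>t\<in>{..i}. \<mu> UNIV / Suc i) < (\<Sum>t\<in>{..i}. \<mu> (S i t))"
      by (intro sum_strict_mono) auto
    also have "\<dots> = \<mu> (\<Union>t\<in>{..i}. S i t)"
      by (rule sum_S) simp
    also have "(\<Union>t\<in>{..i}. S i t) = UNIV"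
      by (auto simp: S_def intro: mod_Suc_le_divisor)
    finally show False by simp
  qed
  then obtain t where t: "\<And>i. t i \<le> i" "\<And>i. \<mu> (S i (t i)) \<le> \<mu> UNIV / Suc i" by metis
  define M where "M = max_card 1"
  obtain n :: nat where n: "M * \<mu> UNIV / \<alpha> < n" using reals_Archimedean2 by blast
  define Y where "Y = (\<Union>i\<in>{n..<n + M}. S i (t i))"
  have Y: "Y \<in> clopen" using S by (auto simp: Y_def)
  have "\<mu> Y \<le> (\<Sum>i\<in>{n..<n + M}. \<mu> (S i (t i)))"
    unfolding Y_def using S by (intro subadd) auto
  also have "\<dots> \<le> (\<Sum>i\<in>{n..<n + M}. \<mu> UNIV / Suc n)"
  proof (rule sum_mono)
    fix i assume "i \<in> {n..<n + M}"
    then have "\<mu> UNIV / Suc i \<le> \<mu> UNIV / Suc n"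
      using mu(1)[OF top] by (intro divide_left_mono) auto
    with t(2)[of i] show "\<mu> (S i (t i)) \<le> \<mu> UNIV / Suc n" by linarith
  qed
  also have "\<dots> = M * \<mu> UNIV / Suc n" by simp
  also have "\<dots> \<le> \<alpha>"
  proof -
    have "M * \<mu> UNIV < n * \<alpha>" using n \<open>0 < \<alpha>\<close> by (simp add: divide_less_eq)
    also have "\<dots> \<le> Suc n * \<alpha>" using \<open>0 < \<alpha>\<close> by (intro mult_right_mono) auto
    finally show ?thesis by (simp add: divide_le_eq mult.commute)
  qed
  finally have "\<mu> Y \<le> \<alpha>" .
  moreover have "1 < nu Y"
  proof -
    have "- Y = {z. \<forall>i\<in>{n..<n + max_card 1}. z i mod Suc i \<noteq> t i}"
      by (auto simp: Y_def S_def M_def)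
    then have "covered 1 ((1 / 2) ^ 1) (- Y)"
      using covered_avoid_coordinates[OF t(1), where k = 1] by simp
    then have "covered 0 (1 / 2) (- Y)" by (rule covered_mono) auto
    then have "nu (- Y) \<le> 1 / 2" by (rule nu_le)
    with nu_Un[of Y "- Y"] nu_UNIV show ?thesis by simp
  qed
  ultimately show ?thesis using Y by blast
qed

section \<open>Simple functions with convergence in submeasure\<close>

definition fin_depends :: "((nat \<Rightarrow> nat) \<Rightarrow> real) set" where
  "fin_depends = {f. \<exists>n. \<forall>z z'. agree n z z' \<longrightarrow> f z = f z'}"

text \<open>The Ky Fan functional of convergence in probability, with \<open>nu\<close> in place of
  the probability.\<close>

definition fnorm :: "((nat \<Rightarrow> nat) \<Rightarrow> real) \<Rightarrow> real" where
  "fnorm f = Inf {e. 0 \<le> e \<and> nu {z. e < \<bar>f z\<bar>} \<le> e}"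

definition L0 :: "(real, (nat \<Rightarrow> nat) \<Rightarrow> real) module" where
  "L0 = \<lparr>carrier = fin_depends, monoid.mult = (\<lambda>f g. f), one = (\<lambda>z. 0), ring.zero = (\<lambda>z. 0),
     ring.add = (\<lambda>f g z. f z + g z), module.smult = (\<lambda>a f z. a * f z)\<rparr>"

definition L0_dist :: "((nat \<Rightarrow> nat) \<Rightarrow> real) \<Rightarrow> ((nat \<Rightarrow> nat) \<Rightarrow> real) \<Rightarrow> real" where
  "L0_dist f g = fnorm (\<lambda>z. f z - g z)"

lemma fnorm_le: "0 \<le> e \<Longrightarrow> nu {z. e < \<bar>f z\<bar>} \<le> e \<Longrightarrow> fnorm f \<le> e"
  unfolding fnorm_def by (intro cInf_lower) (auto intro!: bdd_belowI)

lemma fnorm_le_nu: "fnorm f \<le> nu {z. f z \<noteq> 0}"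
proof (rule fnorm_le)
  show "nu {z. nu {z. f z \<noteq> 0} < \<bar>f z\<bar>} \<le> nu {z. f z \<noteq> 0}"
    using nu_nonneg[of "{z. f z \<noteq> 0}"] by (intro nu_mono) (auto simp: not_less[symmetric])
qed simp

lemma fnorm_set_nonempty: "{e. 0 \<le> e \<and> nu {z. e < \<bar>f z\<bar>} \<le> e} \<noteq> {}"
  using nu_mono[OF subset_UNIV] nu_nonneg by blast

lemma fnorm_nonneg [simp]: "0 \<le> fnorm f"
  unfolding fnorm_def by (rule cInf_greatest[OF fnorm_set_nonempty]) auto

lemma fnorm_less: "fnorm f < e \<Longrightarrow> nu {z. e < \<bar>f z\<bar>} \<le> e"
proof -
  assume "fnorm f < e"
  then obtain e' where e': "0 \<le> e'" "nu {z. e' < \<bar>f z\<bar>} \<le> e'" "e' < e"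
    unfolding fnorm_def using cInf_lessD[OF fnorm_set_nonempty] by blast
  have "nu {z. e < \<bar>f z\<bar>} \<le> nu {z. e' < \<bar>f z\<bar>}" using e'(3) by (intro nu_mono) auto
  with e' show ?thesis by linarith
qed

lemma fnorm_mono:
  assumes "\<And>z. \<bar>f z\<bar> \<le> \<bar>g z\<bar>"
  shows "fnorm f \<le> fnorm g"
proof (rule field_le_epsilon)
  fix e :: real assume "0 < e"
  then have "nu {z. fnorm g + e < \<bar>g z\<bar>} \<le> fnorm g + e" by (intro fnorm_less) simp
  moreover have "nu {z. fnorm g + e < \<bar>f z\<bar>} \<le> nu {z. fnorm g + e < \<bar>g z\<bar>}"
    using assms by (intro nu_mono) (auto intro: less_le_trans)
  ultimately show "fnorm f \<le> fnorm g + e"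
    using \<open>0 < e\<close> by (intro fnorm_le) (auto intro: add_nonneg_nonneg)
qed

text \<open>Where the sum exceeds \<open>a + b\<close> in modulus, \<open>f\<close> exceeds
  \<open>a\<close> or \<open>g\<close> exceeds \<open>b\<close>; subadditivity of \<open>nu\<close>
  does the rest.\<close>

lemma fnorm_add: "fnorm (\<lambda>z. f z + g z) \<le> fnorm f + fnorm g"
proof (rule field_le_epsilon)
  fix e :: real assume e: "0 < e"
  define a where "a = fnorm f + e / 2"
  define b where "b = fnorm g + e / 2"
  have ab: "nu {z. a < \<bar>f z\<bar>} \<le> a" "nu {z. b < \<bar>g z\<bar>} \<le> b"
    unfolding a_def b_def using e by (auto intro!: fnorm_less)
  have "nu {z. a + b < \<bar>f z + g z\<bar>} \<le> nu ({z. a < \<bar>f z\<bar>} \<union> {z. b < \<bar>g z\<bar>})"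
    by (intro nu_mono) auto
  also have "\<dots> \<le> a + b" using nu_Un ab by (rule order_trans[OF _ add_mono])
  finally have "fnorm (\<lambda>z. f z + g z) \<le> a + b"
    using e by (intro fnorm_le) (auto simp: a_def b_def intro!: add_nonneg_nonneg)
  then show "fnorm (\<lambda>z. f z + g z) \<le> fnorm f + fnorm g + e" by (simp add: a_def b_def)
qed

lemma fnorm_const_le: "(\<And>z. \<bar>f z\<bar> \<le> c) \<Longrightarrow> fnorm f \<le> c"
proof -
  assume f: "\<And>z. \<bar>f z\<bar> \<le> c"
  then have "{z. c < \<bar>f z\<bar>} = {}" by (auto simp: not_less)
  moreover have "0 \<le> c" using f[of undefined] by linarith
  ultimately show ?thesis by (intro fnorm_le) auto
qed

lemma fnorm_zero [simp]: "fnorm (\<lambda>z. 0) = 0"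
  using fnorm_const_le[of "\<lambda>z. 0" 0] fnorm_nonneg[of "\<lambda>z. 0"] by simp

text \<open>Subadditivity replaces homogeneity, which a Ky Fan functional lacks; monotonicity then
  extends the bound to real factors.\<close>

lemma fnorm_of_nat_mult: "fnorm (\<lambda>z. real n * f z) \<le> real n * fnorm f"
proof (induction n)
  case (Suc n)
  have "fnorm (\<lambda>z. real (Suc n) * f z) = fnorm (\<lambda>z. f z + real n * f z)" by (simp add: algebra_simps)
  also have "\<dots> \<le> fnorm f + fnorm (\<lambda>z. real n * f z)" by (rule fnorm_add)
  finally show ?case using Suc.IH by (simp add: algebra_simps)
qed simp

lemma fnorm_mult_le:
  assumes "\<bar>a\<bar> \<le> real n"
  shows "fnorm (\<lambda>z. a * f z) \<le> real n * fnorm f"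
proof -
  have "fnorm (\<lambda>z. a * f z) \<le> fnorm (\<lambda>z. real n * f z)"
    using assms by (intro fnorm_mono) (auto simp: abs_mult intro!: mult_right_mono)
  with fnorm_of_nat_mult[of n f] show ?thesis by linarith
qed

text \<open>If \<open>f z \<noteq> 0\<close>, a nonempty set depending on \<open>n\<close>
  coordinates has \<open>\<bar>f\<bar>\<close> above some small \<open>e\<close>, and
  \<open>nu_lower_bound\<close> keeps its submeasure above \<open>e\<close>.\<close>

lemma fnorm_eq_0_iff:
  assumes "f \<in> fin_depends"
  shows "fnorm f = 0 \<longleftrightarrow> f = (\<lambda>z. 0)"
proof
  assume 0: "fnorm f = 0"
  obtain n where n: "\<And>z z'. agree n z z' \<Longrightarrow> f z = f z'" using assms by (auto simp: fin_depends_def)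
  show "f = (\<lambda>z. 0)"
  proof (rule ccontr)
    assume "f \<noteq> (\<lambda>z. 0)"
    then obtain z where z: "f z \<noteq> 0" by auto
    define e where "e = min (\<bar>f z\<bar>) ((1 / 2) ^ (2 * n)) / 2"
    have e: "0 < e" "e < \<bar>f z\<bar>" "e < (1 / 2) ^ (2 * n)"
      using z by (auto simp: e_def min_def)
    have "depends n {z. e < \<bar>f z\<bar>}" unfolding depends_def using n by force
    then have "(1 / 2) ^ (2 * n) \<le> nu {z. e < \<bar>f z\<bar>}"
      using e(2) by (intro nu_lower_bound[of n _ z]) auto
    moreover have "nu {z. e < \<bar>f z\<bar>} \<le> e" using 0 e(1) by (intro fnorm_less) simp
    ultimately show False using e(3) by linarith
  qed
qed simp

text \<open>Boundedness is what makes scalar multiplication continuous in the scalar.\<close>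

lemma fin_depends_bounded:
  assumes "f \<in> fin_depends"
  obtains c where "\<And>z. \<bar>f z\<bar> \<le> c"
proof -
  obtain n where n: "\<And>z z'. agree n z z' \<Longrightarrow> f z = f z'" using assms by (auto simp: fin_depends_def)
  have "\<bar>f z\<bar> \<le> Max ((\<lambda>z. \<bar>f z\<bar>) ` range (rep n))" for z
  proof -
    have "f z = f (rep n z)" by (rule n) simp
    then show ?thesis using finite_range_rep by (intro Max_ge) auto
  qed
  then show thesis by (rule that)
qed

lemma fin_depends_combine:
  assumes "f \<in> fin_depends" "g \<in> fin_depends"
  shows "(\<lambda>z. h (f z) (g z)) \<in> fin_depends"
proof -
  obtain m n where "\<And>z z'. agree m z z' \<Longrightarrow> f z = f z'" "\<And>z z'. agree n z z' \<Longrightarrow> g z = g z'"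
    using assms by (auto simp: fin_depends_def)
  then have "\<forall>z z'. agree (max m n) z z' \<longrightarrow> h (f z) (g z) = h (f z') (g z')"
    by (metis agree_mono max.cobounded1 max.cobounded2)
  then show ?thesis by (auto simp: fin_depends_def)
qed

lemma fin_depends_add: "f \<in> fin_depends \<Longrightarrow> g \<in> fin_depends \<Longrightarrow> (\<lambda>z. f z + g z) \<in> fin_depends"
  using fin_depends_combine[of f g "(+)"] by simp

lemma fin_depends_scale: "f \<in> fin_depends \<Longrightarrow> (\<lambda>z. a * f z) \<in> fin_depends"
  using fin_depends_combine[of f f "\<lambda>x y. a * x"] by simp

lemma fin_depends_const [simp]: "(\<lambda>z. c) \<in> fin_depends"
  by (simp add: fin_depends_def)

lemma fin_depends_indicator: "depends n Y \<Longrightarrow> (indicator Y :: _ \<Rightarrow> real) \<in> fin_depends"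
  unfolding fin_depends_def using depends_iff[of n Y] by (auto simp: indicator_def)

section \<open>The metrizable topological vector space\<close>

lemma module_L0: "Module.module (ring_of_type_algebra :: real ring) L0"
proof (rule moduleI)
  show "abelian_group L0"
  proof (rule abelian_groupI)
    show "\<exists>g\<in>carrier L0. g \<oplus>\<^bsub>L0\<^esub> f = \<zero>\<^bsub>L0\<^esub>" if "f \<in> carrier L0" for f
      using that fin_depends_scale[of f "- 1"]
      by (intro bexI[of _ "\<lambda>z. - f z"]) (auto simp: L0_def)
  qed (auto simp: L0_def fin_depends_add add.assoc add.commute)
qed (auto simp: L0_def ring_of_type_algebra_def algebra_simps fin_depends_scale
    intro: cring_from_type_algebra[unfolded ring_of_type_algebra_def])

lemma metric_L0: "Metric_space (carrier L0) L0_dist"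
proof
  show "0 \<le> L0_dist f g" for f g by (simp add: L0_dist_def)
  have "L0_dist f g \<le> L0_dist g f" for f g
    unfolding L0_dist_def by (intro fnorm_mono) (simp add: abs_minus_commute)
  then show "L0_dist f g = L0_dist g f" for f g by (simp add: order_antisym)
  show "L0_dist f g = 0 \<longleftrightarrow> f = g" if "f \<in> carrier L0" "g \<in> carrier L0" for f g
    using that fin_depends_combine[of f g "(-)"] fnorm_eq_0_iff[of "\<lambda>z. f z - g z"]
    by (auto simp: L0_dist_def L0_def fun_eq_iff)
  show "L0_dist f h \<le> L0_dist f g + L0_dist g h" for f g h
    using fnorm_add[of "\<lambda>z. f z - g z" "\<lambda>z. g z - h z"] by (simp add: L0_dist_def)
qed

interpretation L0: Metric_space "carrier L0" L0_dist
  by (rule metric_L0)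

lemma L0_dist_add: "L0_dist (f \<oplus>\<^bsub>L0\<^esub> g) (f' \<oplus>\<^bsub>L0\<^esub> g') \<le> L0_dist f f' + L0_dist g g'"
proof -
  have "L0_dist (f \<oplus>\<^bsub>L0\<^esub> g) (f' \<oplus>\<^bsub>L0\<^esub> g') = fnorm (\<lambda>z. (f z - f' z) + (g z - g' z))"
    by (simp add: L0_dist_def L0_def algebra_simps)
  also have "\<dots> \<le> L0_dist f f' + L0_dist g g'"
    unfolding L0_dist_def by (rule fnorm_add)
  finally show ?thesis .
qed

lemma L0_dist_smult:
  assumes "\<bar>a'\<bar> \<le> real n" "\<And>z. \<bar>f z\<bar> \<le> c"
  shows "L0_dist (a \<odot>\<^bsub>L0\<^esub> f) (a' \<odot>\<^bsub>L0\<^esub> f') \<le> \<bar>a - a'\<bar> * c + real n * L0_dist f f'"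
proof -
  \<comment> \<open>The difference is split so that the change of scalar meets the bounded
    \<open>f\<close> and the change of function meets the bounded \<open>a'\<close>.\<close>
  have "L0_dist (a \<odot>\<^bsub>L0\<^esub> f) (a' \<odot>\<^bsub>L0\<^esub> f') = fnorm (\<lambda>z. (a - a') * f z + a' * (f z - f' z))"
    by (simp add: L0_dist_def L0_def algebra_simps)
  also have "\<dots> \<le> fnorm (\<lambda>z. (a - a') * f z) + fnorm (\<lambda>z. a' * (f z - f' z))"
    by (rule fnorm_add)
  also have "fnorm (\<lambda>z. (a - a') * f z) \<le> \<bar>a - a'\<bar> * c"
    using assms(2) by (intro fnorm_const_le) (simp add: abs_mult mult_left_mono)
  also have "fnorm (\<lambda>z. a' * (f z - f' z)) \<le> real n * L0_dist f f'"
    unfolding L0_dist_def using assms(1) by (rule fnorm_mult_le)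
  finally show ?thesis by simp
qed

lemma L0_closed:
  "f \<in> carrier L0 \<Longrightarrow> g \<in> carrier L0 \<Longrightarrow> f \<oplus>\<^bsub>L0\<^esub> g \<in> carrier L0"
  "f \<in> carrier L0 \<Longrightarrow> a \<odot>\<^bsub>L0\<^esub> f \<in> carrier L0"
  by (simp_all add: L0_def fin_depends_add fin_depends_scale)

lemma continuous_add_L0:
  "continuous_map (prod_topology L0.mtopology L0.mtopology) L0.mtopology (\<lambda>(f, g). f \<oplus>\<^bsub>L0\<^esub> g)"
  unfolding L0.continuous_map_to_metric
proof (intro ballI allI impI)
  fix x and e :: real
  assume x: "x \<in> topspace (prod_topology L0.mtopology L0.mtopology)" and "0 < e"
  obtain f g where fg: "x = (f, g)" "f \<in> carrier L0" "g \<in> carrier L0" using x by auto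
  let ?U = "L0.mball f (e / 2) \<times> L0.mball g (e / 2)"
  show "\<exists>U. openin (prod_topology L0.mtopology L0.mtopology) U \<and> x \<in> U \<and>
      (\<forall>y\<in>U. (case y of (f, g) \<Rightarrow> f \<oplus>\<^bsub>L0\<^esub> g) \<in> L0.mball (case x of (f, g) \<Rightarrow> f \<oplus>\<^bsub>L0\<^esub> g) e)"
  proof (intro exI[of _ ?U] conjI ballI)
    show "openin (prod_topology L0.mtopology L0.mtopology) ?U" by (simp add: openin_prod_Times_iff)
    show "x \<in> ?U" using fg \<open>0 < e\<close> by simp
    fix y assume "y \<in> ?U"
    then obtain f' g' where y: "y = (f', g')" "f' \<in> carrier L0" "g' \<in> carrier L0"
      "L0_dist f f' < e / 2" "L0_dist g g' < e / 2" by auto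
    have "L0_dist (f \<oplus>\<^bsub>L0\<^esub> g) (f' \<oplus>\<^bsub>L0\<^esub> g') < e"
      using L0_dist_add[of f g f' g'] y(4,5) by linarith
    then show "(case y of (f, g) \<Rightarrow> f \<oplus>\<^bsub>L0\<^esub> g) \<in> L0.mball (case x of (f, g) \<Rightarrow> f \<oplus>\<^bsub>L0\<^esub> g) e"
      using fg y L0_closed by simp
  qed
qed

lemma continuous_smult_L0:
  "continuous_map (prod_topology euclideanreal L0.mtopology) L0.mtopology (\<lambda>(a, f). a \<odot>\<^bsub>L0\<^esub> f)"
  unfolding L0.continuous_map_to_metric
proof (intro ballI allI impI)
  fix x and e :: real
  assume x: "x \<in> topspace (prod_topology euclideanreal L0.mtopology)" and "0 < e"
  obtain a f where af: "x = (a, f)" "f \<in> carrier L0" using x by auto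
  obtain c where c: "\<And>z. \<bar>f z\<bar> \<le> c" using fin_depends_bounded af(2) by (auto simp: L0_def)
  then have "0 \<le> c" by (meson abs_ge_zero order_trans)
  obtain n :: nat where n: "\<bar>a\<bar> + 1 < real n" using reals_Archimedean2 by blast
  \<comment> \<open>\<open>d \<le> 1\<close> keeps nearby scalars below \<open>n\<close> in modulus;
    \<open>c + 1\<close> avoids a zero denominator.\<close>
  define d where "d = min 1 (e / (2 * (c + 1)))"
  have d: "0 < d" "d \<le> 1" using \<open>0 < e\<close> \<open>0 \<le> c\<close> by (auto simp: d_def)
  have "d \<le> e / (2 * (c + 1))" by (simp add: d_def)
  then have dc: "d * (c + 1) \<le> e / 2" using \<open>0 \<le> c\<close> by (simp add: field_simps)
  have "0 < real n" using n by linarith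
  let ?U = "ball a d \<times> L0.mball f (e / (2 * n))"
  show "\<exists>U. openin (prod_topology euclideanreal L0.mtopology) U \<and> x \<in> U \<and>
      (\<forall>y\<in>U. (case y of (a, f) \<Rightarrow> a \<odot>\<^bsub>L0\<^esub> f) \<in> L0.mball (case x of (a, f) \<Rightarrow> a \<odot>\<^bsub>L0\<^esub> f) e)"
  proof (intro exI[of _ ?U] conjI ballI)
    show "openin (prod_topology euclideanreal L0.mtopology) ?U" by (simp add: openin_prod_Times_iff)
    show "x \<in> ?U" using af d(1) \<open>0 < e\<close> \<open>0 < real n\<close> by simp
    fix y assume "y \<in> ?U"
    then obtain a' f' where y: "y = (a', f')" "f' \<in> carrier L0" "\<bar>a - a'\<bar> < d" "L0_dist f f' < e / (2 * n)"
      by (auto simp: dist_real_def)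
    have "\<bar>a'\<bar> \<le> real n" using y(3) d(2) n by linarith
    from L0_dist_smult[OF this c, where a = a and f' = f']
    have "L0_dist (a \<odot>\<^bsub>L0\<^esub> f) (a' \<odot>\<^bsub>L0\<^esub> f') \<le> \<bar>a - a'\<bar> * c + real n * L0_dist f f'" .
    also have "\<bar>a - a'\<bar> * c \<le> d * (c + 1)" using y(3) \<open>0 \<le> c\<close> by (intro mult_mono) auto
    also have "real n * L0_dist f f' < e / 2" using y(4) \<open>0 < real n\<close> by (simp add: field_simps)
    finally have "L0_dist (a \<odot>\<^bsub>L0\<^esub> f) (a' \<odot>\<^bsub>L0\<^esub> f') < e" using dc by linarith
    then show "(case y of (a, f) \<Rightarrow> a \<odot>\<^bsub>L0\<^esub> f) \<in> L0.mball (case x of (a, f) \<Rightarrow> a \<odot>\<^bsub>L0\<^esub> f) e"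
      using af y L0_closed by simp
  qed
qed

lemma invariantly_metrized_L0: "invariantly_metrized_tvs L0 L0.mtopology L0_dist"
proof -
  interpret M: Module.module "ring_of_type_algebra :: real ring" L0 by (rule module_L0)
  show ?thesis
  proof
    show "topspace L0.mtopology = carrier L0" by simp
    show "L0_dist (f \<oplus>\<^bsub>L0\<^esub> h) (g \<oplus>\<^bsub>L0\<^esub> h) = L0_dist f g" for f g h
      by (simp add: L0_dist_def L0_def)
  qed (rule continuous_add_L0 continuous_smult_L0 refl)+
qed

section \<open>Indicators as a vector measure\<close>

definition ind :: "(nat \<Rightarrow> nat) set \<Rightarrow> (nat \<Rightarrow> nat) \<Rightarrow> real" where
  "ind = indicator"

lemma ind_carrier: "Y \<in> clopen \<Longrightarrow> ind Y \<in> carrier L0"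
  using fin_depends_indicator by (auto simp: clopen_def ind_def L0_def)

lemma vector_measure_ind: "vector_measure clopen L0 ind"
  unfolding vector_measure_def
  using ind_carrier by (auto simp: ind_def L0_def indicator_def fun_eq_iff)

lemma exhaustive_ind: "exhaustive clopen L0 L0.mtopology ind"
  unfolding exhaustive_def
proof (intro allI impI)
  fix E :: "nat \<Rightarrow> (nat \<Rightarrow> nat) set"
  assume E: "range E \<subseteq> clopen \<and> disjoint_family E"
  then have depends: "\<exists>n. depends n (E i)" for i by (auto simp: clopen_def)
  have zero: "\<zero>\<^bsub>L0\<^esub> \<in> carrier L0" by (simp add: L0_def)
  have "eventually (\<lambda>i. ind (E i) \<in> carrier L0 \<and> L0_dist (ind (E i)) \<zero>\<^bsub>L0\<^esub> < e) sequentially"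
    if "0 < e" for e
    using nu_exhaustive[OF conjunct2[OF E] depends that]
  proof (rule eventually_mono)
    fix i assume "nu (E i) < e"
    moreover have "{z. ind (E i) z \<noteq> 0} = E i" by (auto simp: ind_def indicator_def)
    then have "L0_dist (ind (E i)) \<zero>\<^bsub>L0\<^esub> \<le> nu (E i)"
      using fnorm_le_nu[of "ind (E i)"] by (simp add: L0_dist_def L0_def)
    ultimately show "ind (E i) \<in> carrier L0 \<and> L0_dist (ind (E i)) \<zero>\<^bsub>L0\<^esub> < e"
      using ind_carrier E by auto
  qed
  with zero show "limitin L0.mtopology (\<lambda>n. ind (E n)) \<zero>\<^bsub>L0\<^esub> sequentially"
    by (simp add: L0.limitin_metric)
qed

lemma no_control_measure_ind: "\<not> control_measure clopen L0 L0_dist ind \<mu>"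
proof
  assume "control_measure clopen L0 L0_dist ind \<mu>"
  then have mu: "positive_measure clopen \<mu>"
    and "\<forall>e>0. \<exists>\<alpha>>0. \<forall>Y\<in>clopen. \<mu> Y \<le> \<alpha> \<longrightarrow> L0_dist \<zero>\<^bsub>L0\<^esub> (ind Y) \<le> e"
    by (auto simp: control_measure_def)
  then obtain \<alpha> where \<alpha>: "0 < \<alpha>" "\<And>Y. Y \<in> clopen \<Longrightarrow> \<mu> Y \<le> \<alpha> \<Longrightarrow> L0_dist \<zero>\<^bsub>L0\<^esub> (ind Y) \<le> 1 / 2"
    by (metis half_gt_zero zero_less_one)
  obtain Y where Y: "Y \<in> clopen" "\<mu> Y \<le> \<alpha>" "1 < nu Y"
    using nu_no_control[OF mu \<alpha>(1)] by blast
  \<comment> \<open>An indicator exceeds 3/4 exactly on its set, so distance at most 1/2 from zero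
    forces \<open>nu Y \<le> 3 / 4\<close>.\<close>
  have "fnorm (\<lambda>z. - ind Y z) < 3 / 4"
    using \<alpha>(2)[OF Y(1,2)] by (simp add: L0_dist_def L0_def)
  from fnorm_less[OF this] have "nu {z. 3 / 4 < \<bar>ind Y z\<bar>} \<le> 3 / 4" by simp
  moreover have "{z. 3 / 4 < \<bar>ind Y z\<bar>} = Y" by (auto simp: ind_def indicator_def)
  ultimately show False using Y(3) by simp
qed

theorem theorem1p4:
  shows "\<exists>(V :: (real, (nat \<Rightarrow> nat) \<Rightarrow> real) module) \<tau> d
           (T :: (nat \<Rightarrow> nat) set) \<B> \<theta>.
           invariantly_metrized_tvs V \<tau> d \<and>
           Sigma_Algebra.algebra T \<B> \<and>
           vector_measure \<B> V \<theta> \<and>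
           exhaustive \<B> V \<tau> \<theta> \<and>
           \<not> (\<exists>\<mu>. control_measure \<B> V d \<theta> \<mu>)"
  using invariantly_metrized_L0 algebra_clopen vector_measure_ind exhaustive_ind no_control_measure_ind
  by blast

end
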